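(* Let $\mathcal{H}$ be a separable infinite-dimensional complex Hilbert space and let $T\in\mathcal{B}(\mathcal{H})$ be an operator that is not an isometry and that can be written as $T=W+K$ with $W$ an isometry on $\mathcal{H}$ and $K$ a compact operator on $\mathcal{H}$. Let $\mathcal{P}$ be the set of all eigenvalues of $(T^*T)^{1/2}$ different from $1$, and for $\beta_n\in\mathcal{P}$ let $k_n$ be its (finite) multiplicity. Then $T$ is quasinormal if and only if $T$ can be written (up to unitary equivalence) as an orthogonal direct sum $D\oplus cU$ for some scalar $c\in\{0,1\}$, where $U$ is an isometry and $D$ is the diagonal operator $$D=\operatorname{diag}_{\beta_n\in\mathcal{P}}\big(\beta_n e^{i t_{n,j}}\big)_{j=1}^{k_n}$$ for some real numbers $t_{n,j}$ ($\beta_n\in\mathcal{P}$, $1\le j\le k_n$).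
   Context: An operator $T\in\mathcal{B}(\mathcal{H})$ is quasinormal if $T(T^*T)=(T^*T)T$; it is an isometry if $T^*T=I$. For such $T$ the operator $(T^*T)^{1/2}$ is diagonalizable and each eigenvalue different from $1$ has finite multiplicity. The notation $\operatorname{diag}_{\beta_n\in\mathcal{P}}(\beta_n e^{i t_{n,j}})_{j=1}^{k_n}$ means an operator that is diagonal with respect to an orthonormal basis indexed by the pairs $(n,j)$ with $\beta_n\in\mathcal{P}$, $1\le j\le k_n$, with diagonal entry $\beta_n e^{i t_{n,j}}$ at the index $(n,j)$. Convention: $c=0$ means that the isometric summand is absent (i.e. $T$ is unitarily equivalent to $D$ alone), and $c=1$ means that it is present, acting on a nonzero space. *)

theory Defs
  imports "HOL-Analysis.Analysis"
begin

section \<open>Complex Hilbert spaces\<close>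

class scaleC =
  fixes scaleC :: "complex \<Rightarrow> 'a \<Rightarrow> 'a" (infixr "*\<^sub>C" 75)

text \<open>
  A complex inner product space is built on top of the library class of real inner product
  spaces: the real inner product is the real part of the complex one, so that the library's
  norm and topology are the usual ones of the complex space.  The inner product is linear in
  its first argument.  Positive definiteness is inherited from \<^class>\<open>real_inner\<close>:
  \<open>cinner x x\<close> is real by conjugate symmetry and equals \<open>inner x x\<close>.
\<close>

class complex_inner = real_inner + scaleC +
  fixes cinner :: "'a \<Rightarrow> 'a \<Rightarrow> complex"
  assumes scaleC_add_right: "a *\<^sub>C (x + y) = a *\<^sub>C x + a *\<^sub>C y"
    and scaleC_add_left: "(a + b) *\<^sub>C x = a *\<^sub>C x + b *\<^sub>C x"
    and scaleC_scaleC: "a *\<^sub>C b *\<^sub>C x = (a * b) *\<^sub>C x"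
    and scaleC_one: "1 *\<^sub>C x = x"
    and scaleR_scaleC: "r *\<^sub>R x = complex_of_real r *\<^sub>C x"
    and cinner_commute: "cinner x y = cnj (cinner y x)"
    and cinner_add_left: "cinner (x + y) z = cinner x z + cinner y z"
    and cinner_scaleC_left: "cinner (a *\<^sub>C x) y = a * cinner x y"
    and Re_cinner: "Re (cinner x y) = inner x y"

class chilbert_space = complex_inner + complete_space

global_interpretation complex_vector: vector_space "scaleC :: complex \<Rightarrow> 'a \<Rightarrow> 'a::complex_inner"
  defines csubspace = complex_vector.subspace
    and cspan = complex_vector.span
    and cdim = complex_vector.dim
  by unfold_locales (simp_all add: scaleC_add_right scaleC_add_left scaleC_scaleC scaleC_one)

text \<open>The product type carries the Hilbert space structure of the orthogonal direct sum.\<close>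

instantiation prod :: (complex_inner, complex_inner) complex_inner
begin

definition scaleC_prod_def: "a *\<^sub>C p = (a *\<^sub>C fst p, a *\<^sub>C snd p)"

definition cinner_prod_def: "cinner p q = cinner (fst p) (fst q) + cinner (snd p) (snd q)"

instance
proof
  fix a b :: complex and r :: real and x y z :: "'a \<times> 'b"
  show "a *\<^sub>C (x + y) = a *\<^sub>C x + a *\<^sub>C y"
    by (simp add: scaleC_prod_def scaleC_add_right)
  show "(a + b) *\<^sub>C x = a *\<^sub>C x + b *\<^sub>C x"
    by (simp add: scaleC_prod_def scaleC_add_left)
  show "a *\<^sub>C b *\<^sub>C x = (a * b) *\<^sub>C x"
    by (simp add: scaleC_prod_def scaleC_scaleC)
  show "1 *\<^sub>C x = x"
    by (simp add: scaleC_prod_def scaleC_one)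
  show "r *\<^sub>R x = complex_of_real r *\<^sub>C x"
    by (simp add: scaleC_prod_def scaleR_prod_def scaleR_scaleC)
  show "cinner x y = cnj (cinner y x)"
    by (simp add: cinner_prod_def cinner_commute[of "fst x"] cinner_commute[of "snd x"])
  show "cinner (x + y) z = cinner x z + cinner y z"
    by (simp add: cinner_prod_def cinner_add_left)
  show "cinner (a *\<^sub>C x) y = a * cinner x y"
    by (simp add: cinner_prod_def scaleC_prod_def cinner_scaleC_left distrib_left)
  show "Re (cinner x y) = inner x y"
    by (simp add: cinner_prod_def inner_prod_def Re_cinner)
qed

end

instance prod :: (chilbert_space, chilbert_space) chilbert_space ..


section \<open>Operators\<close>

text \<open>
  Hilbert spaces are represented by closed subspaces \<open>S\<close> of a type of class
  \<^class>\<open>chilbert_space\<close>, since the summands of a direct sum are existentially quantified and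
  cannot be types.  An operator on \<open>S\<close> is a function on the whole type of which only the
  restriction to \<open>S\<close> matters; operators on the whole space are the case \<open>S = UNIV\<close>.
\<close>

definition closed_csubspace :: "'a::complex_inner set \<Rightarrow> bool" where
  "closed_csubspace S \<longleftrightarrow> csubspace S \<and> closed S"

definition clinear_on :: "'a::complex_inner set \<Rightarrow> ('a \<Rightarrow> 'b::complex_inner) \<Rightarrow> bool" where
  "clinear_on S T \<longleftrightarrow>
     (\<forall>x\<in>S. \<forall>y\<in>S. T (x + y) = T x + T y) \<and> (\<forall>a. \<forall>x\<in>S. T (a *\<^sub>C x) = a *\<^sub>C T x)"

definition bounded_op_on :: "'a::complex_inner set \<Rightarrow> ('a \<Rightarrow> 'a) \<Rightarrow> bool" where
  "bounded_op_on S T \<longleftrightarrow>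
     (\<forall>x\<in>S. T x \<in> S) \<and> clinear_on S T \<and> (\<exists>B. \<forall>x\<in>S. norm (T x) \<le> B * norm x)"

abbreviation bounded_op :: "('a::complex_inner \<Rightarrow> 'a) \<Rightarrow> bool" where
  "bounded_op \<equiv> bounded_op_on UNIV"

text \<open>
  The value of the adjoint at \<open>y\<close> is the Riesz representative in \<open>S\<close> of \<open>x \<mapsto> cinner (T x) y\<close>,
  which exists and is unique for bounded \<open>T\<close> on a closed subspace of a Hilbert space.
\<close>

definition adjoint_on :: "'a::complex_inner set \<Rightarrow> ('a \<Rightarrow> 'a) \<Rightarrow> 'a \<Rightarrow> 'a" where
  "adjoint_on S T y = (THE z. z \<in> S \<and> (\<forall>x\<in>S. cinner (T x) y = cinner x z))"

abbreviation adj :: "('a::complex_inner \<Rightarrow> 'a) \<Rightarrow> 'a \<Rightarrow> 'a" where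
  "adj \<equiv> adjoint_on UNIV"

definition isometry_on :: "'a::complex_inner set \<Rightarrow> ('a \<Rightarrow> 'a) \<Rightarrow> bool" where
  "isometry_on S T \<longleftrightarrow> bounded_op_on S T \<and> (\<forall>x\<in>S. adjoint_on S T (T x) = x)"

definition quasinormal :: "('a::complex_inner \<Rightarrow> 'a) \<Rightarrow> bool" where
  "quasinormal T \<longleftrightarrow> bounded_op T \<and> T \<circ> (adj T \<circ> T) = (adj T \<circ> T) \<circ> T"

definition compact_op :: "('a::complex_inner \<Rightarrow> 'a) \<Rightarrow> bool" where
  "compact_op K \<longleftrightarrow> bounded_op K \<and> compact (closure (K ` cball 0 1))"

definition positive_op :: "('a::complex_inner \<Rightarrow> 'a) \<Rightarrow> bool" where
  "positive_op A \<longleftrightarrow> bounded_op A \<and> (\<forall>x. cinner (A x) x \<in> \<real>\<^sub>\<ge>\<^sub>0)"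

text \<open>The unique positive square root of a positive operator.\<close>

definition op_sqrt :: "('a::complex_inner \<Rightarrow> 'a) \<Rightarrow> 'a \<Rightarrow> 'a" where
  "op_sqrt A = (THE R. positive_op R \<and> R \<circ> R = A)"

definition eigenspace :: "('a::complex_inner \<Rightarrow> 'a) \<Rightarrow> complex \<Rightarrow> 'a set" where
  "eigenspace A l = {x. A x = l *\<^sub>C x}"

definition eigenvalues :: "('a::complex_inner \<Rightarrow> 'a) \<Rightarrow> complex set" where
  "eigenvalues A = {l. \<exists>x. x \<noteq> 0 \<and> A x = l *\<^sub>C x}"

definition multiplicity_of :: "('a::complex_inner \<Rightarrow> 'a) \<Rightarrow> complex \<Rightarrow> nat" where
  "multiplicity_of A l = cdim (eigenspace A l)"


section \<open>Diagonal operators and unitary equivalence\<close>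

definition orthonormal_basis_of ::
  "'a::complex_inner set \<Rightarrow> 'i set \<Rightarrow> ('i \<Rightarrow> 'a) \<Rightarrow> bool" where
  "orthonormal_basis_of S I e \<longleftrightarrow>
     (\<forall>i\<in>I. \<forall>j\<in>I. cinner (e i) (e j) = (if i = j then 1 else 0)) \<and> closure (cspan (e ` I)) = S"

text \<open>\<open>D\<close> is an operator on \<open>S\<close> of the form \<open>diag\<close> with entries \<open>d i\<close>, \<open>i \<in> I\<close>.\<close>

definition diagonal_op_on ::
  "'a::complex_inner set \<Rightarrow> 'i set \<Rightarrow> ('i \<Rightarrow> complex) \<Rightarrow> ('a \<Rightarrow> 'a) \<Rightarrow> bool" where
  "diagonal_op_on S I d D \<longleftrightarrow> bounded_op_on S D \<and>
     (\<exists>e. orthonormal_basis_of S I e \<and> (\<forall>i\<in>I. D (e i) = d i *\<^sub>C e i))"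

definition unitary_between ::
  "'a::complex_inner set \<Rightarrow> 'b::complex_inner set \<Rightarrow> ('a \<Rightarrow> 'b) \<Rightarrow> bool" where
  "unitary_between S S' V \<longleftrightarrow>
     clinear_on S V \<and> V ` S = S' \<and> (\<forall>x\<in>S. \<forall>y\<in>S. cinner (V x) (V y) = cinner x y)"

definition unitarily_equivalent ::
  "'a::complex_inner set \<Rightarrow> ('a \<Rightarrow> 'a) \<Rightarrow> 'b::complex_inner set \<Rightarrow> ('b \<Rightarrow> 'b) \<Rightarrow> bool" where
  "unitarily_equivalent S T S' T' \<longleftrightarrow>
     (\<exists>V. unitary_between S S' V \<and> (\<forall>x\<in>S. V (T x) = T' (V x)))"

text \<open>
  \<open>T\<close> (on the whole space) is unitarily equivalent to \<open>D \<oplus> c U\<close>, where \<open>D\<close> acts on \<open>M\<close> and \<open>U\<close>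
  on \<open>N\<close>.  By convention \<open>c = 0\<close> means that the second summand is absent, and \<open>c = 1\<close> that it is
  present on a nonzero space.
\<close>

definition equivalent_to_sum ::
  "('a::complex_inner \<Rightarrow> 'a) \<Rightarrow> 'b::complex_inner set \<Rightarrow> ('b \<Rightarrow> 'b) \<Rightarrow> nat \<Rightarrow>
     'c::complex_inner set \<Rightarrow> ('c \<Rightarrow> 'c) \<Rightarrow> bool" where
  "equivalent_to_sum T M D c N U \<longleftrightarrow>
     (if c = 0 then unitarily_equivalent UNIV T M D
      else N \<noteq> {0} \<and> unitarily_equivalent UNIV T (M \<times> N) (map_prod D U))"

end

theory Submission
  imports Defs "HOL-Computational_Algebra.Fundamental_Theorem_Algebra"
begin

text \<open>
  \<open>T\<^sup>*T - I = W\<^sup>*K + K\<^sup>*W + K\<^sup>*K\<close> is compact and selfadjoint, so the space is the orthogonal sum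
  of the eigenspaces of \<open>T\<^sup>*T\<close>, and those for eigenvalues \<open>\<lambda> \<noteq> 1\<close> are finite-dimensional.  If \<open>T\<close> is
  quasinormal, it commutes with \<open>T\<^sup>*T\<close> and hence leaves each eigenspace invariant, acting on it as
  \<open>\<surd>\<lambda>\<close> times an isometry: for \<open>\<lambda> \<noteq> 1\<close> this is diagonalizable with eigenvalues of modulus \<open>\<surd>\<lambda>\<close>, and
  for \<open>\<lambda> = 1\<close> it is the isometric summand.  Conversely, for \<open>T = D \<oplus> U\<close> the operator \<open>T\<^sup>*T\<close> is
  \<open>D\<^sup>*D \<oplus> I\<close>, which commutes with \<open>T\<close>.
\<close>

section \<open>Complex inner product spaces\<close>

text \<open>\<open>op_sqrt\<close> is a definite description, so nothing is known about the root of
  T*T until a positive root is shown to exist and to be unique. The total set of eigenvectors of T*T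
  gives both: a root can be prescribed on eigenvectors, and every positive root is forced to take
  the prescribed values there. It also follows that an eigenvalue b of the root has the same
  eigenspace as b^2 for T*T, so that P and the multiplicities can be read off from T*T.
  Diagonalization on such an eigenspace rests on the identity <T x, T y> = b^2 <x, y>: it makes the
  orthogonal complement of an eigenvector of T invariant, so eigenvectors can be split off until the
  finite dimension is exhausted. The value b = 0 fits in, T being zero on the kernel of T*T. In the
  converse direction the identity <y, T*T x> = <T y, T x> determines T*T on a total set of vectors
  without any formula for the adjoint itself.\<close>

instance chilbert_space \<subseteq> banach ..

lemma cinner_add_right: "cinner x (y + z) = cinner x y + cinner x z"
  for x :: "'a::complex_inner"
  by (simp add: cinner_commute[of x] cinner_add_left)

lemma cinner_scaleC_right: "cinner x (a *\<^sub>C y) = cnj a * cinner x y"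
  for x :: "'a::complex_inner"
  by (simp add: cinner_commute[of x] cinner_scaleC_left)

lemma cinner_scaleR_left: "cinner (r *\<^sub>R x) y = of_real r * cinner x y"
  for x :: "'a::complex_inner"
  by (simp add: scaleR_scaleC cinner_scaleC_left)

lemma cinner_scaleR_right: "cinner x (r *\<^sub>R y) = of_real r * cinner x y"
  for x :: "'a::complex_inner"
  by (simp add: scaleR_scaleC cinner_scaleC_right)

lemma cinner_self: "cinner x x = of_real ((norm x)\<^sup>2)"
  for x :: "'a::complex_inner"
proof -
  have "Im (cinner x x) = 0"
    using arg_cong[OF cinner_commute[of x x], of Im] by simp
  then show ?thesis
    by (simp add: complex_eq_iff Re_cinner power2_norm_eq_inner)
qed

lemma norm_scaleC: "norm (a *\<^sub>C x) = cmod a * norm x"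
  for x :: "'a::complex_inner"
proof -
  have "cinner (a *\<^sub>C x) (a *\<^sub>C x) = of_real ((cmod a * norm x)\<^sup>2)"
    by (simp add: cinner_scaleC_left cinner_scaleC_right cinner_self[of x] power_mult_distrib
        mult.assoc[symmetric] complex_norm_square[simplified of_real_power])
  then have "complex_of_real ((norm (a *\<^sub>C x))\<^sup>2) = of_real ((cmod a * norm x)\<^sup>2)"
    by (simp only: cinner_self)
  then have "(norm (a *\<^sub>C x))\<^sup>2 = (cmod a * norm x)\<^sup>2"
    using of_real_eq_iff by blast
  then show ?thesis
    by (simp add: power2_eq_iff_nonneg)
qed

text \<open>A phase \<open>u\<close> rotates \<open>x\<close> until \<open>cinner x y\<close>
  becomes real and nonnegative; there it coincides with the real inner product, and the real
  Cauchy-Schwarz inequality applies.\<close>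

lemma cmod_cinner_le: "cmod (cinner x y) \<le> norm x * norm y"
  for x :: "'a::complex_inner"
proof -
  obtain u where u: "cmod u = 1" "u * cinner x y = of_real (cmod (cinner x y))"
  proof (cases "cinner x y = 0")
    case False
    let ?z = "cinner x y"
    show ?thesis
    proof (rule that)
      show "cmod (cnj ?z / of_real (cmod ?z)) = 1"
        using False by (simp add: norm_divide)
      show "cnj ?z / of_real (cmod ?z) * ?z = of_real (cmod ?z)"
        using False by (simp add: mult.commute[of "cnj ?z"] complex_norm_square[symmetric]
            power2_eq_square)
    qed
  qed (use that[of 1] in simp)
  have "cmod (cinner x y) = Re (cinner (u *\<^sub>C x) y)"
    by (simp add: cinner_scaleC_left u)
  also have "\<dots> \<le> norm (u *\<^sub>C x) * norm y"
    by (simp add: Re_cinner norm_cauchy_schwarz)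
  finally show ?thesis
    by (simp add: norm_scaleC u)
qed

interpretation cinner: bounded_bilinear "cinner :: 'a::complex_inner \<Rightarrow> 'a \<Rightarrow> complex"
proof
  show "\<exists>K. \<forall>a b :: 'a. cmod (cinner a b) \<le> norm a * norm b * K"
    by (rule exI[of _ 1]) (simp add: cmod_cinner_le)
qed (simp_all add: cinner_add_left cinner_add_right cinner_scaleR_left cinner_scaleR_right
    scaleR_conv_of_real)

lemma bounded_linear_scaleC: "bounded_linear (\<lambda>x::'a::complex_inner. a *\<^sub>C x)"
  by (rule bounded_linear_intro[where K = "cmod a"])
    (simp_all add: scaleC_add_right scaleR_scaleC scaleC_scaleC mult.commute norm_scaleC)

lemma cinner_ext:
  fixes y z :: "'a::complex_inner"
  assumes "\<And>x. cinner x y = cinner x z"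
  shows "y = z"
proof -
  have "cinner (y - z) (y - z) = 0"
    using assms by (simp add: cinner.diff_right)
  then show ?thesis
    by (simp add: cinner_self)
qed

lemma cinner_eq_0_commute: "cinner x y = 0 \<longleftrightarrow> cinner y x = 0"
  for x :: "'a::complex_inner"
  by (simp add: cinner_commute[of x])

section \<open>Closed subspaces and closed spans\<close>

lemma closed_csubspaceD:
  assumes "closed_csubspace S"
  shows "closed S" "csubspace S" "0 \<in> S"
    "\<And>x y. x \<in> S \<Longrightarrow> y \<in> S \<Longrightarrow> x + y \<in> S"
    "\<And>x y. x \<in> S \<Longrightarrow> y \<in> S \<Longrightarrow> x - y \<in> S"
    "\<And>a x. x \<in> S \<Longrightarrow> a *\<^sub>C x \<in> S"
    "\<And>r x. x \<in> S \<Longrightarrow> r *\<^sub>R x \<in> S"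
  using assms
  by (auto simp: closed_csubspace_def scaleR_scaleC complex_vector.subspace_0
      complex_vector.subspace_add complex_vector.subspace_diff complex_vector.subspace_scale)

lemma closed_csubspaceI:
  assumes "closed S" "0 \<in> S" "\<And>x y. x \<in> S \<Longrightarrow> y \<in> S \<Longrightarrow> x + y \<in> S"
    "\<And>a x. x \<in> S \<Longrightarrow> a *\<^sub>C x \<in> S"
  shows "closed_csubspace S"
  unfolding closed_csubspace_def complex_vector.subspace_def using assms by blast

lemma closed_csubspace_UNIV [simp]: "closed_csubspace UNIV"
  by (rule closed_csubspaceI) auto

lemma closed_csubspace_closure_cspan:
  "closed_csubspace (closure (cspan X))" for X :: "'a::complex_inner set"
proof (rule closed_csubspaceI)
  show "0 \<in> closure (cspan X)"
    using closure_subset complex_vector.span_zero by blast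
next
  fix x y assume "x \<in> closure (cspan X)" "y \<in> closure (cspan X)"
  then obtain f g where "\<And>n. f n \<in> cspan X" "f \<longlonglongrightarrow> x" "\<And>n. g n \<in> cspan X" "g \<longlonglongrightarrow> y"
    unfolding closure_sequential by blast
  then show "x + y \<in> closure (cspan X)"
    unfolding closure_sequential
    by (intro exI[of _ "\<lambda>n. f n + g n"]) (auto intro: tendsto_add complex_vector.span_add)
next
  fix a x assume "x \<in> closure (cspan X)"
  then obtain f where "\<And>n. f n \<in> cspan X" "f \<longlonglongrightarrow> x"
    unfolding closure_sequential by blast
  then show "a *\<^sub>C x \<in> closure (cspan X)"
    unfolding closure_sequential
    by (intro exI[of _ "\<lambda>n. a *\<^sub>C f n"])
      (auto intro: bounded_linear.tendsto[OF bounded_linear_scaleC] complex_vector.span_scale)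
qed simp

text \<open>Serves as the induction principle for closed spans: with \<open>S\<close> the set of
  vectors that satisfy a closed linear condition, only the generators have to be checked.\<close>

lemma closure_cspan_minimal:
  assumes "closed_csubspace S" "X \<subseteq> S"
  shows "closure (cspan X) \<subseteq> S"
  using assms by (meson closed_csubspace_def closure_minimal complex_vector.span_minimal)

lemma closure_cspan_superset: "X \<subseteq> closure (cspan X)"
  using closure_subset complex_vector.span_superset by blast

lemma closed_csubspace_orthogonal:
  "closed_csubspace {x::'a::complex_inner. \<forall>y\<in>Y. cinner x y = 0}"
proof (rule closed_csubspaceI)
  have "closed (\<Inter>y\<in>Y. {x::'a. cinner x y = 0})"
    by (intro closed_INT ballI closed_Collect_eq continuous_intros cinner.continuous_on)
  then show "closed {x::'a. \<forall>y\<in>Y. cinner x y = 0}"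
    by (simp add: Collect_ball_eq)
qed (auto simp: cinner_add_left cinner_scaleC_left cinner.zero_left)

section \<open>Linear and bounded operators\<close>

lemma clinear_onD:
  assumes "clinear_on S T"
  shows "\<And>x y. x \<in> S \<Longrightarrow> y \<in> S \<Longrightarrow> T (x + y) = T x + T y"
    "\<And>a x. x \<in> S \<Longrightarrow> T (a *\<^sub>C x) = a *\<^sub>C T x"
  using assms by (auto simp: clinear_on_def)

lemma clinear_UNIV:
  assumes "clinear_on UNIV T"
  shows "T (x + y) = T x + T y" "T (a *\<^sub>C x) = a *\<^sub>C T x" "T (x - y) = T x - T y" "T 0 = 0"
    "T (r *\<^sub>R x) = r *\<^sub>R T x"
proof -
  note l = clinear_onD[OF assms, simplified]
  show "T (x + y) = T x + T y" "T (a *\<^sub>C x) = a *\<^sub>C T x" "T (r *\<^sub>R x) = r *\<^sub>R T x"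
    by (simp_all add: l scaleR_scaleC)
  show "T (x - y) = T x - T y"
    using l(1)[of "x - y" y] by simp
  show "T 0 = 0"
    using l(1)[of 0 0] by simp
qed

lemma bounded_opD:
  assumes "bounded_op T"
  shows "clinear_on UNIV T" "bounded_linear T"
proof -
  from assms obtain B where lin: "clinear_on UNIV T" and B: "\<And>x. norm (T x) \<le> B * norm x"
    by (auto simp: bounded_op_on_def)
  show "clinear_on UNIV T"
    by (fact lin)
  show "bounded_linear T"
    by (rule bounded_linear_intro[where K = B]) (simp_all add: clinear_UNIV[OF lin] B mult.commute)
qed

lemma bounded_opI:
  assumes "clinear_on UNIV T" "\<And>x. norm (T x) \<le> B * norm x"
  shows "bounded_op T"
  using assms by (auto simp: bounded_op_on_def)

lemma bounded_op_compose:
  assumes "bounded_op S" "bounded_op T"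
  shows "bounded_op (S \<circ> T)"
proof -
  obtain B where B: "\<And>x. norm (S (T x)) \<le> norm x * B"
    using bounded_linear.bounded[OF bounded_linear_compose[OF bounded_opD(2)[OF assms(1)]
      bounded_opD(2)[OF assms(2)]]] by auto
  show ?thesis
    by (rule bounded_opI[where B = B])
      (use B in \<open>simp_all add: clinear_on_def clinear_UNIV[OF bounded_opD(1)[OF assms(1)]]
        clinear_UNIV[OF bounded_opD(1)[OF assms(2)]] mult.commute\<close>)
qed

lemma closed_csubspace_eigenspace:
  assumes "bounded_op A"
  shows "closed_csubspace (eigenspace A l)"
  unfolding eigenspace_def
proof (rule closed_csubspaceI)
  show "closed {x. A x = l *\<^sub>C x}"
    by (intro closed_Collect_eq linear_continuous_on bounded_opD[OF assms] bounded_linear_scaleC)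
qed (simp_all add: clinear_UNIV[OF bounded_opD(1)[OF assms]] scaleC_add_right scaleC_scaleC
    mult.commute)

lemma bounded_op_eq_on_closure_cspan:
  assumes "bounded_op S" "bounded_op T" "\<And>x. x \<in> X \<Longrightarrow> S x = T x" "x \<in> closure (cspan X)"
  shows "S x = T x"
proof -
  have "closed_csubspace {x. S x = T x}"
    by (rule closed_csubspaceI)
      (use assms(1,2) in \<open>simp_all add: closed_Collect_eq linear_continuous_on[OF bounded_opD(2)]
        clinear_UNIV[OF bounded_opD(1)[OF assms(1)]] clinear_UNIV[OF bounded_opD(1)[OF assms(2)]]\<close>)
  then have "closure (cspan X) \<subseteq> {x. S x = T x}"
    by (rule closure_cspan_minimal) (use assms in blast)
  then show ?thesis
    using assms(4) by blast
qed

lemma maps_closure_cspan: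
  assumes "bounded_op T" "closed_csubspace S" "\<And>x. x \<in> X \<Longrightarrow> T x \<in> S" "x \<in> closure (cspan X)"
  shows "T x \<in> S"
proof -
  have "closed_csubspace {x. T x \<in> S}"
  proof (rule closed_csubspaceI)
    show "closed {x. T x \<in> S}"
      using continuous_closed_vimage[of S T] assms(1,2)
        linear_continuous_at[OF bounded_opD(2)[OF assms(1)]]
      by (simp add: vimage_def closed_csubspace_def)
  qed (use assms(2) in \<open>simp_all add: closed_csubspaceD clinear_UNIV[OF bounded_opD(1)[OF assms(1)]]\<close>)
  then have "closure (cspan X) \<subseteq> {x. T x \<in> S}"
    by (rule closure_cspan_minimal) (use assms in blast)
  then show ?thesis
    using assms(4) by blast
qed

section \<open>Riesz representation and adjoints\<close>

text \<open>The representing vector minimizes \<open>\<parallel>x\<parallel>\<^sup>2 - 2 f x\<close>; by the parallelogram identity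
  every minimizing sequence is Cauchy.\<close>

lemma riesz_real:
  fixes S :: "'a::{real_inner,complete_space} set" and f :: "'a \<Rightarrow> real"
  assumes S: "subspace S" "closed S"
    and add: "\<And>x y. x \<in> S \<Longrightarrow> y \<in> S \<Longrightarrow> f (x + y) = f x + f y"
    and scale: "\<And>r x. x \<in> S \<Longrightarrow> f (r *\<^sub>R x) = r * f x"
    and bound: "\<And>x. x \<in> S \<Longrightarrow> \<bar>f x\<bar> \<le> B * norm x"
  shows "\<exists>z\<in>S. \<forall>x\<in>S. f x = inner x z"
proof -
  define J where "J x = (norm x)\<^sup>2 - 2 * f x" for x
  define m where "m = Inf (J ` S)"
  have S0: "0 \<in> S"
    using S(1) by (rule subspace_0)
  \<comment> \<open>Completing the square: |x|^2 - 2 B |x| = (|x| - B)^2 - B^2.\<close>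
  have "J x \<ge> - B\<^sup>2" if "x \<in> S" for x
  proof -
    have "f x \<le> B * norm x"
      using bound[OF that] by linarith
    moreover have "0 \<le> (norm x - B)\<^sup>2"
      by simp
    ultimately show ?thesis
      by (simp add: J_def power2_diff mult.commute)
  qed
  then have bdd: "bdd_below (J ` S)"
    unfolding bdd_below_def by blast
  have m_le: "m \<le> J x" if "x \<in> S" for x
    unfolding m_def using bdd that by (simp add: cInf_lower)
  have "\<exists>x\<in>S. J x < m + 1 / Suc n" for n
  proof -
    have "Inf (J ` S) < m + 1 / Suc n"
      by (simp add: m_def)
    then show ?thesis
      using cInf_less_iff[OF _ bdd, of "m + 1 / Suc n"] S0 by auto
  qed
  then obtain X where X: "\<And>n. X n \<in> S" "\<And>n. J (X n) < m + 1 / Suc n"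
    by metis
  \<comment> \<open>The midpoint of \<open>x\<close> and \<open>y\<close> lies in \<open>S\<close>,
    so \<open>J\<close> is at least \<open>m\<close> there; the parallelogram identity turns this
    into a bound on the distance by the excesses of \<open>J x\<close> and \<open>J y\<close> over
    \<open>m\<close>.\<close>
  have gap: "(norm (x - y))\<^sup>2 \<le> 2 * (J x - m) + 2 * (J y - m)" if "x \<in> S" "y \<in> S" for x y
  proof -
    have "(1/2) *\<^sub>R (x + y) \<in> S"
      using that S by (simp add: subspace_add subspace_scale)
    from m_le[OF this] have "m \<le> (norm (x + y))\<^sup>2 / 4 - (f x + f y)"
      using that S by (simp add: J_def scale add subspace_add power_mult_distrib power_divide add_divide_distrib)
    moreover have "(norm (x + y))\<^sup>2 = 2 * (norm x)\<^sup>2 + 2 * (norm y)\<^sup>2 - (norm (x - y))\<^sup>2"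
      by (simp add: power2_norm_eq_inner inner_simps inner_commute)
    ultimately show ?thesis
      by (simp add: J_def field_simps)
  qed
  have "Cauchy X"
  proof (rule metric_CauchyI)
    fix e :: real assume e: "e > 0"
    \<comment> \<open>Both excesses enter \<open>gap\<close> with the factor 2, hence the threshold
      e^2/4.\<close>
    obtain N where N: "1 / Suc N < e\<^sup>2 / 4"
      using nat_approx_posE[of "e\<^sup>2 / 4"] e by auto
    have "dist (X i) (X j) < e" if ij: "i \<ge> N" "j \<ge> N" for i j
    proof -
      have "J (X k) - m < e\<^sup>2 / 4" if "k \<ge> N" for k
      proof -
        have "1 / real (Suc k) \<le> 1 / Suc N"
          using that by (simp add: frac_le)
        then show ?thesis
          using N X(2)[of k] by linarith
      qed
      from this[OF ij(1)] this[OF ij(2)]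
      have "2 * (J (X i) - m) + 2 * (J (X j) - m) < e\<^sup>2"
        by argo
      with gap[OF X(1)[of i] X(1)[of j]] have "(norm (X i - X j))\<^sup>2 < e\<^sup>2"
        by (rule order.strict_trans1)
      then show ?thesis
        using e by (simp add: dist_norm power2_less_imp_less)
    qed
    then show "\<exists>M. \<forall>i\<ge>M. \<forall>j\<ge>M. dist (X i) (X j) < e"
      by blast
  qed
  then obtain z where z: "X \<longlonglongrightarrow> z"
    using Cauchy_convergent convergent_def by blast
  have zS: "z \<in> S"
    using S(2) X(1) z closed_sequentially by blast
  have "(\<lambda>n. f (X n - z)) \<longlonglongrightarrow> 0"
  proof (rule Lim_null_comparison)
    have "norm (f (X n - z)) \<le> B * norm (X n - z)" for n
      using bound X(1) zS S by (simp add: subspace_diff)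
    then show "\<forall>\<^sub>F n in sequentially. norm (f (X n - z)) \<le> B * norm (X n - z)"
      by simp
    show "(\<lambda>n. B * norm (X n - z)) \<longlonglongrightarrow> 0"
      using z by (auto intro!: tendsto_eq_intros LIM_zero)
  qed
  moreover have "f (X n - z) = f (X n) - f z" for n
    using add[of "X n - z" z] X(1) zS S by (simp add: subspace_diff)
  ultimately have "(\<lambda>n. f (X n)) \<longlonglongrightarrow> f z"
    by (simp add: LIM_zero_iff)
  then have "(\<lambda>n. J (X n)) \<longlonglongrightarrow> J z"
    unfolding J_def using z by (intro tendsto_intros)
  moreover have "(\<lambda>n. m + 1 / Suc n) \<longlonglongrightarrow> m + 0"
    by (intro tendsto_intros LIMSEQ_Suc lim_1_over_n)
  ultimately have "J z \<le> m"
    using LIMSEQ_le[of "\<lambda>n. J (X n)" "J z" "\<lambda>n. m + 1 / Suc n" m] X(2) by (auto intro: less_imp_le)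
  then have min: "J z \<le> J x" if "x \<in> S" for x
    using m_le[OF that] by linarith
  have "f x = inner x z" if x: "x \<in> S" for x
  proof (cases "x = 0")
    case True
    then show ?thesis using scale[OF S0, of 0] by simp
  next
    case False
    \<comment> \<open>The minimizer of the quadratic t |-> J (z + t x). At this \<open>t\<close> the
      value drops by ((f x - <x, z>) / |x|)^2, which minimality of \<open>z\<close> forces to be
      zero.\<close>
    define t where "t = (f x - inner x z) / (norm x)\<^sup>2"
    have "J z \<le> J (z + t *\<^sub>R x)"
      using x zS S by (intro min) (simp add: subspace_add subspace_scale)
    also have "J (z + t *\<^sub>R x) = J z + t * (t * (norm x)\<^sup>2) - 2 * t * (f x - inner x z)"
      using x zS S by (simp add: J_def add scale subspace_scale power2_norm_eq_inner inner_simps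
          inner_commute algebra_simps)
    also have "t * (norm x)\<^sup>2 = f x - inner x z"
      using False by (simp add: t_def)
    finally have "t * (f x - inner x z) \<le> 0"
      by (simp add: algebra_simps)
    moreover have "t * (f x - inner x z) = ((f x - inner x z) / norm x)\<^sup>2"
      by (simp add: t_def power2_eq_square)
    ultimately show ?thesis
      using False by simp
  qed
  then show ?thesis
    using zS by blast
qed

text \<open>A complex linear functional is determined by its real part: the real representation of
  \<open>Re (f x)\<close>, evaluated at \<i> times \<open>x\<close>, also gives the imaginary
  part.\<close>

lemma riesz:
  fixes f :: "'a::chilbert_space \<Rightarrow> complex"
  assumes S: "closed_csubspace S"
    and add: "\<And>x y. x \<in> S \<Longrightarrow> y \<in> S \<Longrightarrow> f (x + y) = f x + f y"
    and scale: "\<And>a x. x \<in> S \<Longrightarrow> f (a *\<^sub>C x) = a * f x"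
    and bound: "\<And>x. x \<in> S \<Longrightarrow> cmod (f x) \<le> B * norm x"
  shows "\<exists>z\<in>S. \<forall>x\<in>S. f x = cinner x z"
proof -
  have "\<exists>z\<in>S. \<forall>x\<in>S. Re (f x) = inner x z"
  proof (rule riesz_real)
    show "subspace S" "closed S"
      using S by (auto simp: subspace_def closed_csubspaceD)
    show "\<bar>Re (f x)\<bar> \<le> B * norm x" if "x \<in> S" for x
      using bound[OF that] abs_Re_le_cmod[of "f x"] by linarith
  qed (simp_all add: add scale scaleR_scaleC)
  then obtain z where z: "z \<in> S" "\<And>x. x \<in> S \<Longrightarrow> Re (f x) = Re (cinner x z)"
    by (auto simp: Re_cinner)
  have "f x = cinner x z" if "x \<in> S" for x
    using z(2)[OF that] z(2)[of "\<i> *\<^sub>C x"] that S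
    by (simp add: complex_eq_iff scale closed_csubspaceD cinner_scaleC_left)
  then show ?thesis
    using z(1) by blast
qed

section \<open>Adjoints and orthogonal projection\<close>

text \<open>The difference of two representatives lies in \<open>S\<close> and is orthogonal to
  itself. This evaluates the definite description in \<open>adjoint_on\<close>.\<close>

lemma adjoint_on_unique:
  fixes S :: "'a::complex_inner set"
  assumes S: "closed_csubspace S" and z: "z \<in> S" "\<And>x. x \<in> S \<Longrightarrow> cinner (T x) y = cinner x z"
  shows "adjoint_on S T y = z"
  unfolding adjoint_on_def
proof (rule the_equality)
  fix w assume w: "w \<in> S \<and> (\<forall>x\<in>S. cinner (T x) y = cinner x w)"
  then have "cinner (w - z) (w - z) = 0"
    using z closed_csubspaceD(5)[OF S, of w z] by (simp add: cinner.diff_right)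
  then show "w = z"
    by (simp add: cinner_self)
qed (use z in blast)

lemma adjoint_on:
  fixes S :: "'a::chilbert_space set"
  assumes S: "closed_csubspace S" and T: "bounded_op_on S T"
  shows "adjoint_on S T y \<in> S" "x \<in> S \<Longrightarrow> cinner (T x) y = cinner x (adjoint_on S T y)"
proof -
  obtain B where B: "\<And>x. x \<in> S \<Longrightarrow> norm (T x) \<le> B * norm x" and lin: "clinear_on S T"
    using T by (auto simp: bounded_op_on_def)
  have "\<exists>z\<in>S. \<forall>x\<in>S. cinner (T x) y = cinner x z"
  proof (rule riesz[OF S])
    show "cmod (cinner (T x) y) \<le> (B * norm y) * norm x" if "x \<in> S" for x
      using cmod_cinner_le[of "T x" y] mult_right_mono[OF B[OF that] norm_ge_zero[of y]]
      by (simp add: mult_ac)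
  qed (simp_all add: clinear_onD[OF lin] cinner_add_left cinner_scaleC_left)
  then obtain z where z: "z \<in> S" "\<And>x. x \<in> S \<Longrightarrow> cinner (T x) y = cinner x z"
    by blast
  then have "adjoint_on S T y = z"
    by (rule adjoint_on_unique[OF S])
  then show "adjoint_on S T y \<in> S" "x \<in> S \<Longrightarrow> cinner (T x) y = cinner x (adjoint_on S T y)"
    using z by auto
qed

lemma
  fixes T :: "'a::chilbert_space \<Rightarrow> 'a"
  assumes "bounded_op T"
  shows cinner_adj_right: "cinner x (adj T y) = cinner (T x) y"
    and cinner_adj_left: "cinner (adj T x) y = cinner x (T y)"
proof -
  show *: "cinner x (adj T y) = cinner (T x) y" for x y
    using adjoint_on(2)[OF closed_csubspace_UNIV assms] by simp
  show "cinner (adj T x) y = cinner x (T y)"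
    using *[of y x] by (metis cinner_commute)
qed

lemma bounded_op_adj:
  fixes T :: "'a::chilbert_space \<Rightarrow> 'a"
  assumes T: "bounded_op T"
  shows "bounded_op (adj T)"
proof -
  obtain B where B: "\<And>x. norm (T x) \<le> norm x * B" "B > 0"
    using bounded_linear.pos_bounded[OF bounded_opD(2)[OF T]] by blast
  show ?thesis
  proof (rule bounded_opI)
    show "clinear_on UNIV (adj T)"
      unfolding clinear_on_def
    proof (intro conjI ballI allI)
      fix a x y
      show "adj T (x + y) = adj T x + adj T y" "adj T (a *\<^sub>C x) = a *\<^sub>C adj T x"
        by (rule cinner_ext,
            simp add: cinner_adj_right[OF T] cinner_add_right cinner_scaleC_right)+
    qed
    show "norm (adj T y) \<le> B * norm y" for y
    proof (cases "adj T y = 0")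
      case False
      \<comment> \<open>Away from zero, one factor \<open>norm (adj T y)\<close> can be cancelled
        from the resulting inequality.\<close>
      have "(norm (adj T y))\<^sup>2 = Re (cinner (adj T y) (adj T y))"
        by (simp add: cinner_self)
      also have "\<dots> = inner (T (adj T y)) y"
        by (simp only: cinner_adj_right[OF T] Re_cinner)
      also have "\<dots> \<le> norm (T (adj T y)) * norm y"
        by (rule norm_cauchy_schwarz)
      also have "\<dots> \<le> norm (adj T y) * (B * norm y)"
        using mult_right_mono[OF B(1) norm_ge_zero] by (simp add: mult.assoc)
      finally show ?thesis
        using False by (simp add: power2_eq_square)
    qed (use B in simp)
  qed
qed

text \<open>Removes the adjoint relative to \<open>S\<close> in favour of inner products, the form
  in which isometric summands are both verified and used.\<close>

lemma isometry_on_cinner: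
  fixes S :: "'a::chilbert_space set"
  assumes S: "closed_csubspace S" and U: "bounded_op_on S U"
  shows "isometry_on S U \<longleftrightarrow> (\<forall>x\<in>S. \<forall>y\<in>S. cinner (U x) (U y) = cinner x y)"
proof
  assume "isometry_on S U"
  then show "\<forall>x\<in>S. \<forall>y\<in>S. cinner (U x) (U y) = cinner x y"
    using adjoint_on(2)[OF S U] by (simp add: isometry_on_def)
next
  assume "\<forall>x\<in>S. \<forall>y\<in>S. cinner (U x) (U y) = cinner x y"
  then show "isometry_on S U"
    unfolding isometry_on_def using U by (auto intro: adjoint_on_unique[OF S])
qed

text \<open>The projection \<open>y\<close> is the Riesz representative, within \<open>S\<close>, of
  the functional z |-> <z, x>.\<close>

lemma orthogonal_decomposition:
  fixes S :: "'a::chilbert_space set"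
  assumes S: "closed_csubspace S"
  obtains y where "y \<in> S" "\<And>z. z \<in> S \<Longrightarrow> cinner (x - y) z = 0"
proof -
  have "\<exists>y\<in>S. \<forall>z\<in>S. cinner z x = cinner z y"
    by (rule riesz[OF S, where B = "norm x"])
      (simp_all add: cinner_add_left cinner_scaleC_left cmod_cinner_le[THEN order_trans] mult.commute)
  then obtain y where "y \<in> S" "\<And>z. z \<in> S \<Longrightarrow> cinner z (x - y) = 0"
    by (auto simp: cinner.diff_right)
  then show ?thesis
    using that cinner_eq_0_commute by blast
qed

section \<open>Compact selfadjoint operators\<close>

definition selfadjoint_op :: "('a::complex_inner \<Rightarrow> 'a) \<Rightarrow> bool" where
  "selfadjoint_op A \<longleftrightarrow> bounded_op A \<and> (\<forall>x y. cinner (A x) y = cinner x (A y))"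

text \<open>Sequential compactness, for all bounded sequences rather than for the unit ball:
  stability under sums, compositions and adjoints becomes a matter of extracting
  subsequences.\<close>

definition seq_compact_op :: "('a::complex_inner \<Rightarrow> 'a) \<Rightarrow> bool" where
  "seq_compact_op K \<longleftrightarrow> bounded_op K \<and>
     (\<forall>x :: nat \<Rightarrow> 'a. bounded (range x) \<longrightarrow> (\<exists>r. strict_mono r \<and> convergent (\<lambda>n. K (x (r n)))))"

lemma seq_compact_opE:
  fixes x :: "nat \<Rightarrow> 'a::complex_inner"
  assumes "seq_compact_op K" "bounded (range x)"
  obtains r where "strict_mono r" "convergent (\<lambda>n. K (x (r n)))"
  using assms unfolding seq_compact_op_def by blast

lemma compact_op_imp_seq_compact_op:
  assumes K: "compact_op K"
  shows "seq_compact_op K"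
  unfolding seq_compact_op_def
proof (intro conjI allI impI)
  show bK: "bounded_op K"
    using K by (simp add: compact_op_def)
  fix x :: "nat \<Rightarrow> 'a" assume "bounded (range x)"
  then obtain B where B: "B > 0" "\<And>n. norm (x n) \<le> B"
    unfolding bounded_pos by blast
  \<comment> \<open>Scaling by 1/B moves the sequence into the unit ball, to which
    \<open>compact_op\<close> refers; linearity undoes the scaling.\<close>
  have "K ((1 / B) *\<^sub>R x n) \<in> closure (K ` cball 0 1)" for n
    using B by (intro subsetD[OF closure_subset] imageI) (simp add: field_simps)
  then obtain l r where r: "strict_mono r" and
    lim: "((\<lambda>n. K ((1 / B) *\<^sub>R x n)) \<circ> r) \<longlonglongrightarrow> l"
    using K unfolding compact_op_def compact_eq_seq_compact_metric seq_compact_def by meson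
  have "K (x n) = B *\<^sub>R K ((1 / B) *\<^sub>R x n)" for n
    using B(1) by (simp add: clinear_UNIV[OF bounded_opD(1)[OF bK]])
  then have "(\<lambda>n. K (x (r n))) \<longlonglongrightarrow> B *\<^sub>R l"
    using tendsto_scaleR[OF tendsto_const lim, of B] by (simp add: o_def)
  with r show "\<exists>r. strict_mono r \<and> convergent (\<lambda>n. K (x (r n)))"
    unfolding convergent_def by blast
qed

lemma bounded_range_op:
  assumes "bounded_op T" "bounded (range x)"
  shows "bounded (range (\<lambda>n. T (x n)))"
  using bounded_linear_image[OF assms(2) bounded_opD(2)[OF assms(1)]]
  by (simp add: image_image)

lemma convergent_op:
  assumes "bounded_op T" "convergent x"
  shows "convergent (\<lambda>n. T (x n))"
  using assms bounded_linear.tendsto[OF bounded_opD(2)[OF assms(1)]] unfolding convergent_def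
  by blast

lemma bounded_op_add:
  assumes "bounded_op S" "bounded_op T"
  shows "bounded_op (\<lambda>x. S x + T x)"
proof -
  obtain B where B: "\<And>x. norm (S x + T x) \<le> norm x * B"
    using bounded_linear.bounded[OF bounded_linear_add[OF bounded_opD(2)[OF assms(1)]
      bounded_opD(2)[OF assms(2)]]] by auto
  show ?thesis
    by (rule bounded_opI[where B = B])
      (use B in \<open>simp_all add: clinear_on_def clinear_UNIV[OF bounded_opD(1)[OF assms(1)]]
        clinear_UNIV[OF bounded_opD(1)[OF assms(2)]] mult.commute scaleC_add_right\<close>)
qed

lemma seq_compact_op_add:
  assumes "seq_compact_op S" "seq_compact_op T"
  shows "seq_compact_op (\<lambda>x. S x + T x)"
  unfolding seq_compact_op_def
proof (intro conjI allI impI)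
  show "bounded_op (\<lambda>x. S x + T x)"
    using assms by (simp add: seq_compact_op_def bounded_op_add)
  fix x :: "nat \<Rightarrow> 'a" assume x: "bounded (range x)"
  obtain r where r: "strict_mono r" "convergent (\<lambda>n. S (x (r n)))"
    using seq_compact_opE[OF assms(1) x] .
  have xr: "bounded (range (\<lambda>n. x (r n)))"
    using x by (rule bounded_subset) auto
  obtain q where q: "strict_mono q" "convergent (\<lambda>n. T (x (r (q n))))"
    using seq_compact_opE[OF assms(2) xr] .
  have "convergent (\<lambda>n. S (x (r (q n))))"
    using convergent_subseq_convergent[OF r(2) q(1)] by (simp add: o_def)
  then have "convergent (\<lambda>n. S (x ((r \<circ> q) n)) + T (x ((r \<circ> q) n)))"
    using q(2) by (simp add: convergent_add)
  then show "\<exists>r. strict_mono r \<and> convergent (\<lambda>n. S (x (r n)) + T (x (r n)))"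
    using strict_mono_o[OF r(1) q(1)] by blast
qed

lemma seq_compact_op_compose_left:
  assumes "bounded_op T" "seq_compact_op K"
  shows "seq_compact_op (T \<circ> K)"
  unfolding seq_compact_op_def
proof (intro conjI allI impI)
  show "bounded_op (T \<circ> K)"
    using assms by (simp add: seq_compact_op_def bounded_op_compose)
  fix x :: "nat \<Rightarrow> 'a" assume x: "bounded (range x)"
  obtain r where "strict_mono r" "convergent (\<lambda>n. K (x (r n)))"
    using seq_compact_opE[OF assms(2) x] .
  then show "\<exists>r. strict_mono r \<and> convergent (\<lambda>n. (T \<circ> K) (x (r n)))"
    using convergent_op[OF assms(1)] by auto
qed

lemma seq_compact_op_compose_right:
  assumes "seq_compact_op K" "bounded_op T"
  shows "seq_compact_op (K \<circ> T)"
  unfolding seq_compact_op_def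
proof (intro conjI allI impI)
  show "bounded_op (K \<circ> T)"
    using assms by (simp add: seq_compact_op_def bounded_op_compose)
  fix x :: "nat \<Rightarrow> 'a" assume x: "bounded (range x)"
  show "\<exists>r. strict_mono r \<and> convergent (\<lambda>n. (K \<circ> T) (x (r n)))"
    using seq_compact_opE[OF assms(1) bounded_range_op[OF assms(2) x]] by (auto simp: o_def)
qed

text \<open>Schauder's theorem. With d a difference of two members of the sequence, |K* d|^2 = <K K*
  d, d> <= |K K* d| |d|, so a subsequence on which K K* converges is one on which K* is
  Cauchy.\<close>

lemma seq_compact_op_adj:
  fixes K :: "'a::chilbert_space \<Rightarrow> 'a"
  assumes K: "seq_compact_op K"
  shows "seq_compact_op (adj K)"
  unfolding seq_compact_op_def
proof (intro conjI allI impI)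
  have bK: "bounded_op K"
    using K by (simp add: seq_compact_op_def)
  show ba: "bounded_op (adj K)"
    using bK by (rule bounded_op_adj)
  fix x :: "nat \<Rightarrow> 'a" assume x: "bounded (range x)"
  then obtain B where B: "B > 0" "\<And>n. norm (x n) \<le> B"
    unfolding bounded_pos by blast
  obtain r where r: "strict_mono r" "convergent (\<lambda>n. K (adj K (x (r n))))"
    using seq_compact_opE[OF K bounded_range_op[OF ba x]] .
  define y where "y n = x (r n)" for n
  have le: "(norm (adj K (y i) - adj K (y j)))\<^sup>2
      \<le> norm (K (adj K (y i)) - K (adj K (y j))) * (2 * B)" for i j
  proof -
    let ?d = "y i - y j"
    have "(norm (adj K (y i) - adj K (y j)))\<^sup>2 = Re (cinner (adj K ?d) (adj K ?d))"
      by (simp add: cinner_self clinear_UNIV[OF bounded_opD(1)[OF ba]])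
    also have "\<dots> = inner (K (adj K ?d)) ?d"
      by (simp only: cinner_adj_right[OF bK] Re_cinner)
    also have "\<dots> \<le> norm (K (adj K ?d)) * norm ?d"
      by (rule norm_cauchy_schwarz)
    also have "\<dots> \<le> norm (K (adj K ?d)) * (2 * B)"
      using norm_triangle_ineq4[of "y i" "y j"] B(2)[of "r i"] B(2)[of "r j"]
      by (intro mult_left_mono) (auto simp: y_def)
    finally show ?thesis
      by (simp add: clinear_UNIV[OF bounded_opD(1)[OF ba]] clinear_UNIV[OF bounded_opD(1)[OF bK]])
  qed
  have "Cauchy (\<lambda>n. K (adj K (y n)))"
    using r(2) by (simp add: y_def convergent_Cauchy)
  have "Cauchy (\<lambda>n. adj K (y n))"
  proof (rule metric_CauchyI)
    fix e :: real assume e: "e > 0"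
    then have "e\<^sup>2 / (2 * B) > 0"
      using B by simp
    then obtain M where M: "\<And>i j. i \<ge> M \<Longrightarrow> j \<ge> M \<Longrightarrow>
        norm (K (adj K (y i)) - K (adj K (y j))) < e\<^sup>2 / (2 * B)"
      using metric_CauchyD[OF \<open>Cauchy (\<lambda>n. K (adj K (y n)))\<close>] unfolding dist_norm by blast
    have "dist (adj K (y i)) (adj K (y j)) < e" if "i \<ge> M" "j \<ge> M" for i j
    proof -
      have "norm (K (adj K (y i)) - K (adj K (y j))) * (2 * B) < e\<^sup>2"
        using M[OF that] B(1) by (simp add: pos_less_divide_eq)
      with le[of i j] have "(norm (adj K (y i) - adj K (y j)))\<^sup>2 < e\<^sup>2"
        by (rule order.strict_trans1)
      then show ?thesis
        using e by (simp add: dist_norm power2_less_imp_less)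
    qed
    then show "\<exists>M. \<forall>i\<ge>M. \<forall>j\<ge>M. dist (adj K (y i)) (adj K (y j)) < e"
      by blast
  qed
  then show "\<exists>r. strict_mono r \<and> convergent (\<lambda>n. adj K (x (r n)))"
    using r(1) by (auto simp: y_def Cauchy_convergent_iff)
qed

text \<open>A maximizing sequence for \<open>\<parallel>C x\<parallel>\<close> on the unit sphere yields an eigenvector of \<open>C\<^sup>2\<close>,
  and \<open>C\<^sup>2 - m\<^sup>2\<close> factors.\<close>

lemma compact_selfadjoint_eigenvector:
  fixes C :: "'a::chilbert_space \<Rightarrow> 'a"
  assumes S: "closed_csubspace S" and inv: "\<And>x. x \<in> S \<Longrightarrow> C x \<in> S"
    and sa: "selfadjoint_op C" and cpt: "seq_compact_op C"
    and x0: "x0 \<in> S" "C x0 \<noteq> 0"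
  obtains v l where "v \<in> S" "v \<noteq> 0" "l \<noteq> 0" "C v = l *\<^sub>C v"
proof -
  have bC: "bounded_op C" and sym: "\<And>x y. cinner (C x) y = cinner x (C y)"
    using sa by (auto simp: selfadjoint_op_def)
  note lin = clinear_UNIV[OF bounded_opD(1)[OF bC]]
  obtain B where B: "\<And>x. norm (C x) \<le> norm x * B"
    using bounded_linear.bounded[OF bounded_opD(2)[OF bC]] by blast
  \<comment> \<open>\<open>m\<close> is the norm of \<open>C\<close> restricted to \<open>S\<close>;
    \<open>x0\<close> ensures that \<open>S\<close> has unit vectors and that \<open>m\<close> is
    positive.\<close>
  define N where "N = {norm (C x) | x. x \<in> S \<and> norm x = 1}"
  define m where "m = Sup N"
  have bdd: "bdd_above N"
  proof (rule bdd_aboveI)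
    fix s assume "s \<in> N"
    then obtain x where "s = norm (C x)" "norm x = 1"
      by (auto simp: N_def)
    then show "s \<le> B"
      using B[of x] by simp
  qed
  have le1: "norm (C x) \<le> m" if "x \<in> S" "norm x = 1" for x
    unfolding m_def by (rule cSup_upper[OF _ bdd]) (use that in \<open>auto simp: N_def\<close>)
  have le: "norm (C x) \<le> m * norm x" if x: "x \<in> S" for x
  proof (cases "x = 0")
    case False
    have "norm (C ((1 / norm x) *\<^sub>R x)) \<le> m"
      by (rule le1) (use x False S in \<open>simp_all add: closed_csubspaceD\<close>)
    then show ?thesis
      using False by (simp add: lin field_simps)
  qed (simp add: lin)
  have x0n: "x0 \<noteq> 0"
    using x0(2) lin by auto
  have "0 < m * norm x0"
    using le[OF x0(1)] x0(2) by (meson order.strict_trans2 zero_less_norm_iff)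
  then have m: "m > 0"
    using x0n by (simp add: zero_less_mult_iff)
  have "norm (C ((1 / norm x0) *\<^sub>R x0)) \<in> N"
    unfolding N_def using x0 x0n S by (auto simp: closed_csubspaceD)
  then have ne: "N \<noteq> {}"
    by blast
  have "\<exists>x\<in>S. norm x = 1 \<and> m - 1 / Suc n < norm (C x)" for n
  proof -
    have "\<exists>s\<in>N. m - 1 / Suc n < s"
      using less_cSup_iff[OF ne bdd, of "m - 1 / Suc n"] by (simp add: m_def)
    then show ?thesis
      by (auto simp: N_def)
  qed
  then obtain X where X: "\<And>n. X n \<in> S" "\<And>n. norm (X n) = 1" "\<And>n. m - 1 / Suc n < norm (C (X n))"
    by metis
  have lim_m: "(\<lambda>n. norm (C (X n))) \<longlonglongrightarrow> m"
  proof (rule real_tendsto_sandwich)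
    have "(\<lambda>n. m - 1 / Suc n) \<longlonglongrightarrow> m - 0"
      by (intro tendsto_intros LIMSEQ_Suc lim_1_over_n)
    then show "(\<lambda>n. m - 1 / Suc n) \<longlonglongrightarrow> m"
      by simp
    show "\<forall>\<^sub>F n in sequentially. m - 1 / Suc n \<le> norm (C (X n))"
      by (rule always_eventually) (use X(3) less_imp_le in blast)
  qed (use X le1 in auto)
  have bX: "bounded (range X)"
    unfolding bounded_iff using X(2) by auto
  obtain r where r: "strict_mono r" "convergent (\<lambda>n. C (X (r n)))"
    using seq_compact_opE[OF cpt bX] .
  then obtain y where y: "(\<lambda>n. C (X (r n))) \<longlonglongrightarrow> y"
    unfolding convergent_def by blast
  have yS: "y \<in> S"
    by (rule closed_sequentially[OF closed_csubspaceD(1)[OF S] _ y]) (simp add: X inv)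
  have lim_r: "(\<lambda>n. norm (C (X (r n)))) \<longlonglongrightarrow> m"
    using LIMSEQ_subseq_LIMSEQ[OF lim_m r(1)] by (simp add: o_def)
  have "norm y = m"
    using LIMSEQ_unique[OF tendsto_norm[OF y] lim_r] .
  then have y0: "y \<noteq> 0"
    using m by auto
  \<comment> \<open>Measures how far the maximizing vectors are from being eigenvectors of C^2 for
    m^2. Expanding the square and using |C C x| <= m |C x| gives the bound \<open>D_le\<close>,
    which tends to 0.\<close>
  define D where "D n = C (C (X (r n))) - m\<^sup>2 *\<^sub>R X (r n)" for n
  have D_le: "(norm (D n))\<^sup>2 \<le> m\<^sup>2 * (m\<^sup>2 - (norm (C (X (r n))))\<^sup>2)" for n
  proof -
    let ?x = "X (r n)"
    have 1: "inner (C (C ?x)) ?x = (norm (C ?x))\<^sup>2"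
      using arg_cong[OF sym[of "C ?x" ?x], of Re] by (simp add: cinner_self flip: Re_cinner)
    have 2: "(norm (C (C ?x)))\<^sup>2 \<le> m\<^sup>2 * (norm (C ?x))\<^sup>2"
      using power_mono[OF le[OF inv[OF X(1)[of "r n"]]] norm_ge_zero, of 2]
      by (simp add: power_mult_distrib)
    have "(norm (D n))\<^sup>2 = (norm (C (C ?x)))\<^sup>2 - 2 * m\<^sup>2 * inner (C (C ?x)) ?x
        + m\<^sup>2 * m\<^sup>2 * (norm ?x)\<^sup>2"
      unfolding D_def by (simp add: power2_norm_eq_inner inner_simps inner_commute algebra_simps)
    then show ?thesis
      using 1 2 X(2)[of "r n"] by (simp add: algebra_simps)
  qed
  have "D \<longlonglongrightarrow> 0"
  proof -
    have "(\<lambda>n. m\<^sup>2 * (m\<^sup>2 - (norm (C (X (r n))))\<^sup>2)) \<longlonglongrightarrow> m\<^sup>2 * (m\<^sup>2 - m\<^sup>2)"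
      using lim_r by (intro tendsto_intros)
    then have "(\<lambda>n. (norm (D n))\<^sup>2) \<longlonglongrightarrow> 0"
      by (intro Lim_null_comparison[of "\<lambda>n. (norm (D n))\<^sup>2", OF always_eventually]) (simp_all add: D_le)
    then have "(\<lambda>n. norm (D n)) \<longlonglongrightarrow> 0"
      using tendsto_real_sqrt[of "\<lambda>n. (norm (D n))\<^sup>2" 0] by simp
    then show ?thesis
      by (simp add: tendsto_norm_zero_iff)
  qed
  note tC = bounded_linear.tendsto[OF bounded_opD(2)[OF bC]]
  \<comment> \<open>Convergence of the images \<open>C (X (r n))\<close> is thereby carried over to
    the vectors \<open>X (r n)\<close> themselves, up to the factor m^2; applying \<open>C\<close>
    once more identifies \<open>C (C y)\<close>.\<close>
  have "(\<lambda>n. C (C (X (r n))) - D n) \<longlonglongrightarrow> C y - 0"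
    by (intro tendsto_diff tC y \<open>D \<longlonglongrightarrow> 0\<close>)
  then have "(\<lambda>n. m\<^sup>2 *\<^sub>R X (r n)) \<longlonglongrightarrow> C y"
    by (simp add: D_def)
  from tC[OF this] have "(\<lambda>n. m\<^sup>2 *\<^sub>R C (X (r n))) \<longlonglongrightarrow> C (C y)"
    by (simp add: lin)
  then have CC: "C (C y) = m\<^sup>2 *\<^sub>R y"
    using LIMSEQ_unique tendsto_scaleR[OF tendsto_const y] by blast
  show ?thesis
  \<comment> \<open>(C - m) (C + m) y = 0, so either \<open>y\<close> is an eigenvector for -m, or
    (C + m) y is a nonzero eigenvector for m.\<close>
  proof (cases "C y + m *\<^sub>R y = 0")
    case True
    then have "C y = - of_real m *\<^sub>C y"
      by (simp add: add_eq_0_iff scaleR_scaleC complex_vector.scale_minus_left)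
    then show ?thesis
      using that[of y "- of_real m"] yS y0 m by simp
  next
    case False
    have "C (C y + m *\<^sub>R y) = of_real m *\<^sub>C (C y + m *\<^sub>R y)"
      by (simp add: lin CC power2_eq_square scaleR_add_right flip: scaleR_scaleC)
    moreover have "C y + m *\<^sub>R y \<in> S"
      using S yS inv by (simp add: closed_csubspaceD)
    ultimately show ?thesis
      using that[OF _ False, of "of_real m"] m by simp
  qed
qed

text \<open>The orthogonal complement of all eigenvectors with nonzero eigenvalue is invariant under
  \<open>C\<close>. If \<open>C\<close> did not vanish on it, it would contain one of these
  eigenvectors, which would then be orthogonal to itself.\<close>

lemma compact_selfadjoint_orthogonal_eigenvectors:
  fixes C :: "'a::chilbert_space \<Rightarrow> 'a"
  assumes sa: "selfadjoint_op C" and cpt: "seq_compact_op C"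
    and x: "\<And>l y. l \<noteq> 0 \<Longrightarrow> C y = l *\<^sub>C y \<Longrightarrow> cinner x y = 0"
  shows "C x = 0"
proof (rule ccontr)
  assume Cx: "C x \<noteq> 0"
  define X where "X = {y. \<exists>l. l \<noteq> 0 \<and> C y = l *\<^sub>C y}"
  define S where "S = {x. \<forall>y\<in>X. cinner x y = 0}"
  have "C z \<in> S" if "z \<in> S" for z
    using that sa by (auto simp: S_def X_def selfadjoint_op_def cinner_scaleC_right)
  moreover have "closed_csubspace S"
    unfolding S_def by (rule closed_csubspace_orthogonal)
  moreover have "x \<in> S"
    using x by (auto simp: S_def X_def)
  ultimately obtain v l where "v \<in> S" "v \<noteq> 0" "l \<noteq> 0" "C v = l *\<^sub>C v"
    using compact_selfadjoint_eigenvector[OF _ _ sa cpt _ Cx] by metis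
  then show False
    by (auto simp: S_def X_def cinner_self)
qed

section \<open>Square roots\<close>

text \<open>The relation passes from generators to closed spans one argument at a time. The operator
  \<open>J\<close> allows sesquilinear identities between components of pairs to be written as
  orthogonality.\<close>

lemma cinner_op_eq_0_closure_cspan:
  assumes J: "bounded_op J" and eq: "\<And>x y. x \<in> X \<Longrightarrow> y \<in> Y \<Longrightarrow> cinner (J x) y = 0"
    and x: "x \<in> closure (cspan X)" and y: "y \<in> closure (cspan Y)"
  shows "cinner (J x) y = 0"
proof -
  have "J x \<in> {z. \<forall>y\<in>Y. cinner z y = 0}"
    by (rule maps_closure_cspan[OF J closed_csubspace_orthogonal _ x]) (use eq in blast)
  then have "closure (cspan Y) \<subseteq> {z. \<forall>y\<in>{J x}. cinner z y = 0}"
    by (intro closure_cspan_minimal closed_csubspace_orthogonal)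
      (auto simp: cinner_eq_0_commute[of "J x"])
  then show ?thesis
    using y cinner_eq_0_commute by blast
qed

text \<open>The square root is the operator whose graph is the closed span of the pairs
  \<open>(e, \<surd>l\<^sub>e e)\<close>.  Its symmetry and the fact that it squares to \<open>A\<close> are orthogonality relations
  in the product space, which need only be checked on these pairs.\<close>

lemma selfadjoint_sqrt_exists:
  fixes A :: "'a::chilbert_space \<Rightarrow> 'a" and l :: "'a \<Rightarrow> real"
  assumes A: "selfadjoint_op A" and total: "closure (cspan X) = UNIV"
    and eig: "\<And>e. e \<in> X \<Longrightarrow> 0 \<le> l e" "\<And>e. e \<in> X \<Longrightarrow> A e = of_real (l e) *\<^sub>C e"
  obtains R where "selfadjoint_op R" "R \<circ> R = A" "\<And>e. e \<in> X \<Longrightarrow> R e = of_real (sqrt (l e)) *\<^sub>C e"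
proof -
  have bA: "bounded_op A" and sym: "\<And>x y. cinner (A x) y = cinner x (A y)"
    using A by (auto simp: selfadjoint_op_def)
  note lin = clinear_UNIV[OF bounded_opD(1)[OF bA]]
  obtain B where B: "\<And>x. norm (A x) \<le> norm x * B" "B > 0"
    using bounded_linear.pos_bounded[OF bounded_opD(2)[OF bA]] by blast
  define P where "P = (\<lambda>e. (e, of_real (sqrt (l e)) *\<^sub>C e)) ` X"
  define G where "G = closure (cspan P)"
  have G: "closed_csubspace G"
    unfolding G_def by (rule closed_csubspace_closure_cspan)
  have orth: "(l e - l f) * cinner e f = 0" if "e \<in> X" "f \<in> X" for e f
    using sym[of e f] eig(2) that by (simp add: cinner_scaleC_left cinner_scaleC_right algebra_simps)
  have sq: "cinner (snd p) (snd q) = cinner (A (fst p)) (fst q)" if "p \<in> G" "q \<in> G" for p q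
  proof -
    \<comment> \<open>With this \<open>J\<close>, orthogonality of \<open>J p\<close> and
      \<open>q\<close> is the identity to be proved.\<close>
    define J where "J p = (- A (fst p), snd p)" for p :: "'a \<times> 'a"
    have "bounded_op J"
    proof (rule bounded_opI)
      show "clinear_on UNIV J"
        by (simp add: clinear_on_def J_def lin scaleC_prod_def complex_vector.scale_minus_right)
      show "norm (J p) \<le> (B + 1) * norm p" for p
      proof -
        have "norm (J p) \<le> norm (A (fst p)) + norm (snd p)"
          using norm_Pair_le[of "- A (fst p)" "snd p"] by (simp add: J_def)
        also have "\<dots> \<le> norm p * B + norm p"
        proof (rule add_mono)
          have "norm (fst p) \<le> norm p" "norm (snd p) \<le> norm p"
            using norm_fst_le[of "fst p" "snd p"] norm_snd_le[of "snd p" "fst p"] by simp_all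
          then show "norm (A (fst p)) \<le> norm p * B" "norm (snd p) \<le> norm p"
            using order_trans[OF B(1)[of "fst p"] mult_right_mono] B(2) by auto
        qed
        finally show ?thesis
          by (simp add: algebra_simps)
      qed
    qed
    moreover have "cinner (J p) q = 0" if "p \<in> P" "q \<in> P" for p q
    proof -
      from that obtain e f where ef: "e \<in> X" "f \<in> X"
        and p: "p = (e, of_real (sqrt (l e)) *\<^sub>C e)" and q: "q = (f, of_real (sqrt (l f)) *\<^sub>C f)"
        by (auto simp: P_def)
      \<comment> \<open>Nonorthogonal eigenvectors share their eigenvalue, and then the product of
        the two roots is that eigenvalue.\<close>
      have "sqrt (l f) * sqrt (l e) = l e \<or> cinner e f = 0"
        using orth[OF ef] eig(1)[OF ef(1)] by auto
      then show ?thesis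
        using eig(2)[OF ef(1)]
        by (auto simp: p q J_def cinner_prod_def cinner_scaleC_left cinner_scaleC_right
            cinner.minus_left simp flip: of_real_mult mult.assoc)
    qed
    ultimately have "cinner (J p) q = 0"
      using that cinner_op_eq_0_closure_cspan[of J P P p q] by (simp add: G_def)
    then show ?thesis
      by (simp add: J_def cinner_prod_def cinner.minus_left)
  qed
  have sym_G: "cinner (snd p) (fst q) = cinner (fst p) (snd q)" if "p \<in> G" "q \<in> G" for p q
  proof -
    \<comment> \<open>The rotation by a right angle that tests symmetry of a graph: the graph is
      orthogonal to its own image.\<close>
    define J where "J p = (snd p, - fst p)" for p :: "'a \<times> 'a"
    have "bounded_op J"
    proof (rule bounded_opI)
      show "clinear_on UNIV J"
        by (simp add: clinear_on_def J_def scaleC_prod_def complex_vector.scale_minus_right)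
      show "norm (J p) \<le> 1 * norm p" for p
        by (cases p) (simp add: J_def norm_prod_def add.commute)
    qed
    moreover have "cinner (J p) q = 0" if "p \<in> P" "q \<in> P" for p q
    proof -
      from that obtain e f where ef: "e \<in> X" "f \<in> X"
        and p: "p = (e, of_real (sqrt (l e)) *\<^sub>C e)" and q: "q = (f, of_real (sqrt (l f)) *\<^sub>C f)"
        by (auto simp: P_def)
      have "l e = l f \<or> cinner e f = 0"
        using orth[OF ef] by auto
      then show ?thesis
        by (auto simp: p q J_def cinner_prod_def cinner_scaleC_left cinner_scaleC_right
            cinner.minus_left)
    qed
    ultimately have "cinner (J p) q = 0"
      using that cinner_op_eq_0_closure_cspan[of J P P p q] by (simp add: G_def)
    then show ?thesis
      by (simp add: J_def cinner_prod_def cinner.minus_left)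
  qed
  \<comment> \<open>Taking p = q in \<open>sq\<close> bounds the second component by the first. This
    makes \<open>G\<close> the graph of a bounded operator and keeps its projection to the first
    factor bounded below.\<close>
  have snd_le: "norm (snd p) \<le> sqrt B * norm (fst p)" if "p \<in> G" for p
  proof -
    have "(norm (snd p))\<^sup>2 = inner (A (fst p)) (fst p)"
      using arg_cong[OF sq[OF that that], of Re] by (simp only: cinner_self Re_cinner Re_complex_of_real)
    also have "\<dots> \<le> norm (A (fst p)) * norm (fst p)"
      by (rule norm_cauchy_schwarz)
    also have "\<dots> \<le> norm (fst p) * B * norm (fst p)"
      by (intro mult_right_mono B) simp
    also have "\<dots> = (sqrt B * norm (fst p))\<^sup>2"
      using B(2) by (simp add: power_mult_distrib power2_eq_square mult_ac)
    finally show ?thesis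
      by (rule power2_le_imp_le) (use B(2) in simp)
  qed
  have "complete (fst ` G)"
  proof (rule complete_isometric_image)
    show "0 < 1 / (1 + sqrt B)"
      using B(2) by (simp add: add_pos_pos)
    show "subspace G"
      using G by (simp add: subspace_def closed_csubspaceD)
    show "bounded_linear (fst :: 'a \<times> 'a \<Rightarrow> 'a)"
      by (rule bounded_linear_fst)
    show "complete G"
      using closed_csubspaceD(1)[OF G] by (simp add: complete_eq_closed)
    show "\<forall>x\<in>G. 1 / (1 + sqrt B) * norm x \<le> norm (fst x)"
    proof
      fix p assume "p \<in> G"
      from snd_le[OF this] have "norm p \<le> (1 + sqrt B) * norm (fst p)"
        using norm_Pair_le[of "fst p" "snd p"] by (simp add: algebra_simps)
      then show "1 / (1 + sqrt B) * norm p \<le> norm (fst p)"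
        using B(2) by (simp add: add_pos_pos field_simps)
    qed
  qed
  then have "closed_csubspace (fst ` G)"
  proof (intro closed_csubspaceI)
    show "0 \<in> fst ` G"
      using closed_csubspaceD(3)[OF G] by force
    show "x + y \<in> fst ` G" if "x \<in> fst ` G" "y \<in> fst ` G" for x y
      using that closed_csubspaceD(4)[OF G] by (metis (no_types, lifting) fst_add image_iff)
    show "a *\<^sub>C x \<in> fst ` G" if x: "x \<in> fst ` G" for a x
    proof -
      obtain p where "p \<in> G" "x = fst p"
        using x by blast
      then have "a *\<^sub>C p \<in> G" "a *\<^sub>C x = fst (a *\<^sub>C p)"
        using closed_csubspaceD(6)[OF G] by (auto simp: scaleC_prod_def)
      then show ?thesis
        by blast
    qed
  qed (simp add: complete_eq_closed)
  moreover have "X \<subseteq> fst ` G"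
  proof -
    have "P \<subseteq> G"
      unfolding G_def by (rule closure_cspan_superset)
    then show ?thesis
      by (force simp: P_def)
  qed
  ultimately have "UNIV \<subseteq> fst ` G"
    using closure_cspan_minimal total by blast
  then have "\<exists>z. (x, z) \<in> G" for x
    by force
  then obtain R where R: "\<And>x. (x, R x) \<in> G"
    by metis
  \<comment> \<open>Two points of \<open>G\<close> over the same \<open>x\<close> differ by a pair
    with first component 0, whose second component vanishes by \<open>snd_le\<close>.\<close>
  have R_eq: "R x = z" if "(x, z) \<in> G" for x z
  proof -
    have "(x, R x) - (x, z) \<in> G"
      using closed_csubspaceD(5)[OF G] R that by blast
    from snd_le[OF this] show ?thesis
      by simp
  qed
  have bR: "bounded_op R"
  proof (rule bounded_opI)
    show "clinear_on UNIV R"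
      unfolding clinear_on_def
    proof (intro conjI ballI allI)
      fix a x y
      show "R (x + y) = R x + R y"
        using closed_csubspaceD(4)[OF G R[of x] R[of y]] by (intro R_eq) simp
      show "R (a *\<^sub>C x) = a *\<^sub>C R x"
        using closed_csubspaceD(6)[OF G R[of x], of a] by (intro R_eq) (simp add: scaleC_prod_def)
    qed
    show "norm (R x) \<le> sqrt B * norm x" for x
      using snd_le[OF R[of x]] by simp
  qed
  have symR: "cinner (R x) y = cinner x (R y)" for x y
    using sym_G[OF R R, of x y] by simp
  show ?thesis
  proof (rule that)
    show "selfadjoint_op R"
      using bR symR by (simp add: selfadjoint_op_def)
    show "R \<circ> R = A"
    proof (rule ext, rule cinner_ext)
      fix x y
      have "cinner y ((R \<circ> R) x) = cinner (A y) x"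
        using sq[OF R R, of y x] by (simp add: symR)
      then show "cinner y ((R \<circ> R) x) = cinner y (A x)"
        by (simp add: sym)
    qed
    show "R e = of_real (sqrt (l e)) *\<^sub>C e" if "e \<in> X" for e
      using that closure_cspan_superset[of P] by (intro R_eq) (auto simp: G_def P_def)
  qed
qed

text \<open>Polarization: reality of the quadratic form at x + y compares imaginary parts, and at
  \<i> x + y it compares real parts.\<close>

lemma positive_op_imp_selfadjoint_op:
  fixes A :: "'a::complex_inner \<Rightarrow> 'a"
  assumes A: "positive_op A"
  shows "selfadjoint_op A"
proof -
  have b: "bounded_op A" and pos: "\<And>x. cinner (A x) x \<in> \<real>\<^sub>\<ge>\<^sub>0"
    using A by (auto simp: positive_op_def)
  note lin = clinear_UNIV[OF bounded_opD(1)[OF b]]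
  have im: "Im (cinner (A x) x) = 0" for x
    using pos[of x] by (simp add: complex_nonneg_Reals_iff)
  have "cinner (A x) y = cnj (cinner (A y) x)" for x y
  proof -
    have "Im (cinner (A x) y) + Im (cinner (A y) x) = 0"
      using im[of "x + y"] im[of x] im[of y] by (simp add: lin cinner_add_left cinner_add_right)
    moreover have "Re (cinner (A x) y) - Re (cinner (A y) x) = 0"
      using im[of "\<i> *\<^sub>C x + y"] im[of x] im[of y]
      by (simp add: lin cinner_add_left cinner_add_right cinner_scaleC_left cinner_scaleC_right)
    ultimately show ?thesis
      by (simp add: complex_eq_iff)
  qed
  then show ?thesis
    using b by (simp add: selfadjoint_op_def flip: cinner_commute)
qed

text \<open>For l > 0 the vector y = R e - l e satisfies R y = -l y, which positivity allows only
  for y = 0; for l = 0, |R e|^2 = <e, R R e> = 0. This is uniqueness of the positive root, one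
  eigenvector at a time.\<close>

lemma positive_op_sqrt_eigenvector:
  fixes R :: "'a::complex_inner \<Rightarrow> 'a"
  assumes R: "positive_op R" and l: "0 \<le> l" and e: "R (R e) = of_real (l\<^sup>2) *\<^sub>C e"
  shows "R e = of_real l *\<^sub>C e"
proof -
  have b: "bounded_op R" and sym: "\<And>x y. cinner (R x) y = cinner x (R y)"
    using positive_op_imp_selfadjoint_op[OF R] by (auto simp: selfadjoint_op_def)
  note lin = clinear_UNIV[OF bounded_opD(1)[OF b]]
  show ?thesis
  proof (cases "l = 0")
    case True
    then have "cinner (R e) (R e) = 0"
      using e by (simp add: sym cinner.zero_right)
    then show ?thesis
      using True by (simp add: cinner_self)
  next
    case False
    define y where "y = R e - of_real l *\<^sub>C e"
    have "R y = - of_real l *\<^sub>C y"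
      using e by (simp add: y_def lin complex_vector.scale_right_diff_distrib scaleC_scaleC
          power2_eq_square)
    then have "cinner (R y) y = - of_real (l * (norm y)\<^sup>2)"
      by (simp add: cinner_scaleC_left cinner_self cinner.minus_left)
    moreover have "0 \<le> Re (cinner (R y) y)"
      using R by (simp add: positive_op_def complex_nonneg_Reals_iff)
    ultimately have "y = 0"
      using l False by (simp add: mult_le_0_iff)
    then show ?thesis
      by (simp add: y_def)
  qed
qed

text \<open>Evaluates the definite description \<open>op_sqrt A\<close>. Every positive root of
  \<open>A\<close> multiplies each \<open>e\<close> in \<open>X\<close> by
  \<open>sqrt (l e)\<close>, so any two agree on a dense span and hence everywhere.\<close>

lemma op_sqrt_eigenvectors:
  fixes A :: "'a::chilbert_space \<Rightarrow> 'a" and l :: "'a \<Rightarrow> real"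
  assumes A: "selfadjoint_op A" and total: "closure (cspan X) = UNIV"
    and eig: "\<And>e. e \<in> X \<Longrightarrow> 0 \<le> l e" "\<And>e. e \<in> X \<Longrightarrow> A e = of_real (l e) *\<^sub>C e"
  shows "positive_op (op_sqrt A)" "op_sqrt A \<circ> op_sqrt A = A"
proof -
  obtain R where R: "selfadjoint_op R" "R \<circ> R = A" "\<And>e. e \<in> X \<Longrightarrow> R e = of_real (sqrt (l e)) *\<^sub>C e"
    using selfadjoint_sqrt_exists[OF assms] by blast
  \<comment> \<open>\<open>R\<close> itself has a selfadjoint square root, hence is positive.\<close>
  obtain Q where Q: "selfadjoint_op Q" "Q \<circ> Q = R"
    using selfadjoint_sqrt_exists[OF R(1) total, of "\<lambda>e. sqrt (l e)"] R(3) eig(1) by auto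
  have "cinner (R x) x = of_real ((norm (Q x))\<^sup>2)" for x
    using Q(1) by (simp add: selfadjoint_op_def cinner_self flip: Q(2))
  then have pos: "positive_op R"
    using R(1) by (auto simp: positive_op_def selfadjoint_op_def complex_nonneg_Reals_iff)
  have unique: "S = R" if "positive_op S \<and> S \<circ> S = A" for S
  proof
    fix x
    have "S e = R e" if e: "e \<in> X" for e
    proof -
      have "S (S e) = of_real ((sqrt (l e))\<^sup>2) *\<^sub>C e"
        using \<open>positive_op S \<and> S \<circ> S = A\<close> eig[OF e] by (metis comp_apply real_sqrt_pow2)
      then show ?thesis
        using positive_op_sqrt_eigenvector[of S "sqrt (l e)" e] that R(3)[OF e]
          \<open>positive_op S \<and> S \<circ> S = A\<close> eig(1)[OF e] by simp
    qed
    then show "S x = R x"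
      using bounded_op_eq_on_closure_cspan[of S R X x] that R(1) total
      by (auto simp: positive_op_def selfadjoint_op_def)
  qed
  have "op_sqrt A = R"
    unfolding op_sqrt_def by (rule the_equality) (use pos R(2) unique in blast)+
  then show "positive_op (op_sqrt A)" "op_sqrt A \<circ> op_sqrt A = A"
    using pos R(2) by auto
qed

section \<open>Orthonormal eigenbases in finite dimension\<close>

text \<open>A set rather than an indexed family, so that Zorn's lemma applies to inclusion.\<close>

definition orthonormal_set :: "'a::complex_inner set \<Rightarrow> bool" where
  "orthonormal_set B \<longleftrightarrow> (\<forall>x\<in>B. \<forall>y\<in>B. cinner x y = (if x = y then 1 else 0))"

lemma orthonormal_setD:
  assumes "orthonormal_set B" "x \<in> B" "y \<in> B"
  shows "cinner x y = (if x = y then 1 else 0)"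
  using assms by (auto simp: orthonormal_set_def)

lemma orthonormal_set_norm:
  assumes "orthonormal_set B" "x \<in> B"
  shows "norm x = 1"
proof -
  have "complex_of_real ((norm x)\<^sup>2) = of_real 1"
    using orthonormal_setD[OF assms assms(2)] by (simp only: cinner_self of_real_1 if_True simp_thms)
  then have "(norm x)\<^sup>2 = 1"
    by (simp only: of_real_eq_iff)
  then show ?thesis
    by (simp add: power2_eq_1_iff) (use norm_ge_zero[of x] in linarith)
qed

lemma orthonormal_set_independent:
  assumes B: "orthonormal_set B" "finite B"
  shows "\<not> complex_vector.dependent B"
proof
  assume "complex_vector.dependent B"
  then obtain u v where v: "v \<in> B" "u v \<noteq> 0" and sum: "(\<Sum>w\<in>B. u w *\<^sub>C w) = 0"
    using complex_vector.dependent_finite[OF B(2)] by auto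
  have "cinner (\<Sum>w\<in>B. u w *\<^sub>C w) v = (\<Sum>w\<in>B. if w = v then u w else 0)"
    unfolding cinner.sum_left
    by (rule sum.cong) (use orthonormal_setD[OF B(1) _ v(1)] in \<open>auto simp: cinner_scaleC_left\<close>)
  also have "\<dots> = u v"
    using v B by simp
  finally show False
    using v by (simp add: sum cinner.zero_left)
qed

lemma orthonormal_expansion_remainder:
  assumes B: "orthonormal_set B" "finite B" and b: "b \<in> B"
  shows "cinner (x - (\<Sum>c\<in>B. cinner x c *\<^sub>C c)) b = 0"
proof -
  have "cinner (\<Sum>c\<in>B. cinner x c *\<^sub>C c) b = (\<Sum>c\<in>B. if c = b then cinner x c else 0)"
    unfolding cinner.sum_left
    by (rule sum.cong) (use orthonormal_setD[OF B(1) _ b] in \<open>auto simp: cinner_scaleC_left\<close>)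
  also have "\<dots> = cinner x b"
    using b B by simp
  finally show ?thesis
    by (simp add: cinner.diff_left)
qed

text \<open>Zorn's lemma. \<open>Q\<close> may be any set of vectors, so that one statement covers
  both a subspace and the set of eigenvectors inside it.\<close>

lemma maximal_orthonormal_set:
  obtains B where "B \<subseteq> Q" "orthonormal_set B"
    "\<And>v. v \<in> Q \<Longrightarrow> norm v = 1 \<Longrightarrow> \<exists>b\<in>B. cinner v b \<noteq> 0"
proof -
  define \<A> where "\<A> = {B. B \<subseteq> Q \<and> orthonormal_set B}"
  have "\<exists>M\<in>\<A>. \<forall>X\<in>\<A>. M \<subseteq> X \<longrightarrow> X = M"
  proof (rule subset_Zorn')
    fix \<C> assume chain: "subset.chain \<A> \<C>"
    have "orthonormal_set (\<Union>\<C>)"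
      unfolding orthonormal_set_def
    proof (intro ballI)
      fix x y assume "x \<in> \<Union>\<C>" "y \<in> \<Union>\<C>"
      then obtain X Y where XY: "X \<in> \<C>" "Y \<in> \<C>" "x \<in> X" "y \<in> Y"
        by blast
      then have "X \<subseteq> Y \<or> Y \<subseteq> X"
        using chain unfolding subset_chain_def by blast
      then obtain Z where "Z \<in> \<C>" "x \<in> Z" "y \<in> Z"
        using XY by blast
      moreover have "orthonormal_set Z"
        using chain \<open>Z \<in> \<C>\<close> by (auto simp: subset_chain_def \<A>_def)
      ultimately show "cinner x y = (if x = y then 1 else 0)"
        using orthonormal_setD by blast
    qed
    then show "\<Union>\<C> \<in> \<A>"
      using chain by (auto simp: subset_chain_def \<A>_def)
  qed
  then obtain B where B: "B \<subseteq> Q" "orthonormal_set B"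
    and max: "\<And>X. X \<subseteq> Q \<Longrightarrow> orthonormal_set X \<Longrightarrow> B \<subseteq> X \<Longrightarrow> X = B"
    by (auto simp: \<A>_def)
  have "\<exists>b\<in>B. cinner v b \<noteq> 0" if v: "v \<in> Q" "norm v = 1" for v
  proof (rule ccontr)
    assume "\<not> (\<exists>b\<in>B. cinner v b \<noteq> 0)"
    then have orth: "cinner v b = 0" "cinner b v = 0" if "b \<in> B" for b
      using that cinner_eq_0_commute by blast+
    have vv: "cinner v v = 1"
      using v(2) by (simp add: cinner_self)
    have "v \<notin> B"
      using orth(1) vv by force
    then have "orthonormal_set (insert v B)"
      using orth vv orthonormal_setD[OF B(2)] by (auto simp: orthonormal_set_def)
    then have "insert v B = B"
      using max B v(1) by blast
    with \<open>v \<notin> B\<close> show False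
      by blast
  qed
  with B show ?thesis
    using that by blast
qed

text \<open>Distinct orthonormal vectors have distance sqrt 2. On the eigenspace \<open>C\<close> is
  multiplication by the nonzero \<open>l\<close>, so a convergent sequence of images would yield a
  Cauchy sequence of such vectors.\<close>

lemma finite_orthonormal_set_compact_eigenspace:
  assumes C: "seq_compact_op C" and l: "l \<noteq> 0" and B: "orthonormal_set B" "B \<subseteq> eigenspace C l"
  shows "finite B"
proof (rule ccontr)
  assume "infinite B"
  then obtain f :: "nat \<Rightarrow> 'a" where f: "inj f" "range f \<subseteq> B"
    using infinite_countable_subset by blast
  have "norm (f n) = 1" for n
    using orthonormal_set_norm[OF B(1)] f(2) by blast
  then have "bounded (range f)"
    unfolding bounded_iff by (intro exI[of _ 1]) auto
  then obtain r where r: "strict_mono r" "convergent (\<lambda>n. C (f (r n)))"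
    by (rule seq_compact_opE[OF C])
  have "C (f n) = l *\<^sub>C f n" for n
    using f(2) B(2) by (auto simp: eigenspace_def)
  then have "convergent (\<lambda>n. l *\<^sub>C f (r n))"
    using r(2) by simp
  then obtain y where "(\<lambda>n. l *\<^sub>C f (r n)) \<longlonglongrightarrow> y"
    unfolding convergent_def by blast
  then have "(\<lambda>n. inverse l *\<^sub>C l *\<^sub>C f (r n)) \<longlonglongrightarrow> inverse l *\<^sub>C y"
    by (rule bounded_linear.tendsto[OF bounded_linear_scaleC])
  then have "(\<lambda>n. f (r n)) \<longlonglongrightarrow> inverse l *\<^sub>C y"
    using l by (simp add: scaleC_scaleC scaleC_one)
  then have "Cauchy (\<lambda>n. f (r n))"
    by (rule LIMSEQ_imp_Cauchy)
  then obtain M where M: "\<And>i j. i \<ge> M \<Longrightarrow> j \<ge> M \<Longrightarrow> dist (f (r i)) (f (r j)) < 1"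
    using metric_CauchyD[of "\<lambda>n. f (r n)" 1] by auto
  define x where "x = f (r M)"
  define y where "y = f (r (Suc M))"
  have xy: "x \<in> B" "y \<in> B" "x \<noteq> y"
    using f strict_mono_less[OF r(1), of M "Suc M"] by (auto simp: x_def y_def dest: injD)
  have "inner x y = 0"
    using orthonormal_setD[OF B(1) xy(1,2)] xy(3) by (simp flip: Re_cinner)
  then have "(norm (x - y))\<^sup>2 = (norm x)\<^sup>2 + (norm y)\<^sup>2"
    by (simp add: power2_norm_eq_inner inner_simps inner_commute)
  then have "(norm (x - y))\<^sup>2 = 2"
    using orthonormal_set_norm[OF B(1)] xy by simp
  moreover have "norm (x - y) < 1"
    using M[of M "Suc M"] by (simp add: x_def y_def dist_norm)
  ultimately show False
    using power_mono[of "norm (x - y)" 1 2] by simp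
qed

section \<open>Eigenvectors in finite-dimensional invariant subspaces\<close>

text \<open>The vector p(T) x, evaluated by Horner's scheme.\<close>

definition op_poly :: "('a::complex_inner \<Rightarrow> 'a) \<Rightarrow> 'a \<Rightarrow> complex poly \<Rightarrow> 'a" where
  "op_poly T x p = fold_coeffs (\<lambda>a y. a *\<^sub>C x + T y) p 0"

context
  fixes T :: "'a::complex_inner \<Rightarrow> 'a" and x :: 'a
  assumes T: "clinear_on UNIV T"
begin

lemma op_poly_0: "op_poly T x 0 = 0"
  by (simp add: op_poly_def)

lemma op_poly_pCons: "op_poly T x (pCons a p) = a *\<^sub>C x + T (op_poly T x p)"
  by (cases "p = 0 \<and> a = 0") (auto simp: op_poly_def clinear_UNIV[OF T])

lemma op_poly_add: "op_poly T x (p + q) = op_poly T x p + op_poly T x q"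
  by (induction p q rule: poly_induct2)
    (simp_all add: op_poly_0 op_poly_pCons clinear_UNIV[OF T] scaleC_add_left)

lemma op_poly_smult: "op_poly T x (smult c p) = c *\<^sub>C op_poly T x p"
  by (induction p)
    (simp_all add: op_poly_0 op_poly_pCons clinear_UNIV[OF T] scaleC_add_right scaleC_scaleC)

lemma op_poly_monom: "op_poly T x (monom a n) = a *\<^sub>C (T ^^ n) x"
  by (induction n) (simp_all add: monom_0 monom_Suc op_poly_0 op_poly_pCons clinear_UNIV[OF T])

lemma op_poly_sum: "op_poly T x (\<Sum>i\<in>I. p i) = (\<Sum>i\<in>I. op_poly T x (p i))"
  by (induction I rule: infinite_finite_induct) (simp_all add: op_poly_0 op_poly_add)

lemma op_poly_in_csubspace:
  assumes "csubspace G" "\<And>y. y \<in> G \<Longrightarrow> T y \<in> G" "x \<in> G"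
  shows "op_poly T x p \<in> G"
  using assms
  by (induction p) (simp_all add: op_poly_0 op_poly_pCons complex_vector.subspace_0
      complex_vector.subspace_add complex_vector.subspace_scale)

text \<open>Split off a root: p = (X - z) q. Either q(T) x is nonzero and is an eigenvector for
  \<open>z\<close>, or \<open>q\<close> annihilates \<open>x\<close> and has smaller degree.\<close>

lemma eigenvector_of_annihilator:
  assumes G: "csubspace G" "\<And>y. y \<in> G \<Longrightarrow> T y \<in> G" "x \<in> G" and x: "x \<noteq> 0"
    and p: "p \<noteq> 0" "op_poly T x p = 0"
  shows "\<exists>v z. v \<in> G \<and> v \<noteq> 0 \<and> T v = z *\<^sub>C v"
  using p
proof (induction "degree p" arbitrary: p rule: less_induct)
  case less
  have "degree p \<noteq> 0"
  proof
    assume "degree p = 0"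
    then obtain c where "p = [:c:]"
      by (rule degree_eq_zeroE)
    then show False
      using less.prems x by (simp add: op_poly_pCons op_poly_0 clinear_UNIV[OF T])
  qed
  then obtain z where "poly p z = 0"
    using fundamental_theorem_of_algebra[of p] by (auto simp: constant_degree)
  then obtain q where q: "p = [:- z, 1:] * q"
    by (auto simp: poly_eq_0_iff_dvd)
  then have "q \<noteq> 0"
    using less.prems by auto
  have deg: "degree q < degree p"
    unfolding q using \<open>q \<noteq> 0\<close> by (subst degree_mult_eq) auto
  have "p = pCons 0 q + smult (- z) q"
    by (simp add: q)
  then have eq: "T (op_poly T x q) = z *\<^sub>C op_poly T x q"
    using less.prems(2)
    by (simp add: op_poly_add op_poly_pCons op_poly_smult del: smult_minus_left)
  show ?case
  proof (cases "op_poly T x q = 0")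
    case True
    then show ?thesis
      using less.hyps[OF deg \<open>q \<noteq> 0\<close>] by blast
  next
    case False
    then show ?thesis
      using eq op_poly_in_csubspace[OF G] by blast
  qed
qed

text \<open>The n + 1 vectors x, T x, ..., T^n x in the span of n vectors satisfy a linear relation,
  that is, a nonzero polynomial annihilates \<open>x\<close>.\<close>

lemma finite_dimensional_eigenvector:
  assumes F: "finite F" "G \<subseteq> cspan F"
    and G: "csubspace G" "\<And>y. y \<in> G \<Longrightarrow> T y \<in> G" "x \<in> G" and x: "x \<noteq> 0"
  shows "\<exists>v z. v \<in> G \<and> v \<noteq> 0 \<and> T v = z *\<^sub>C v"
proof -
  define n where "n = card F"
  define f where "f i = (T ^^ i) x" for i
  have fG: "f i \<in> G" for i
    by (induction i) (simp_all add: f_def G)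
  have "\<exists>p. p \<noteq> 0 \<and> op_poly T x p = 0"
  \<comment> \<open>Dependence of a set does not see repetitions; if two iterates coincide, the
    difference of the two monomials annihilates \<open>x\<close>.\<close>
  proof (cases "inj_on f {..n}")
    case True
    have "card (f ` {..n}) = Suc n"
      using True by (simp add: card_image)
    then have "complex_vector.dependent (f ` {..n})"
      using complex_vector.independent_span_bound[OF F(1), of "f ` {..n}"] fG F(2) n_def by auto
    then obtain u j where j: "j \<le> n" "u (f j) \<noteq> 0" and sum: "(\<Sum>v\<in>f ` {..n}. u v *\<^sub>C v) = 0"
      using complex_vector.dependent_finite[of "f ` {..n}"] by auto
    define p where "p = (\<Sum>i\<le>n. monom (u (f i)) i)"
    have "coeff p j = u (f j)"
      using j(1) by (simp add: p_def coeff_sum)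
    then have "p \<noteq> 0"
      using j(2) by auto
    moreover have "op_poly T x p = 0"
      using sum by (simp add: p_def op_poly_sum op_poly_monom sum.reindex[OF True])
        (simp add: f_def)
    ultimately show ?thesis
      by blast
  next
    case False
    then obtain i j where ij: "i \<noteq> j" "f i = f j"
      by (auto simp: inj_on_def)
    define p where "p = monom (1 :: complex) i + monom (- 1) j"
    have "coeff p i = 1"
      using ij(1) by (simp add: p_def)
    then have "p \<noteq> 0"
      by auto
    moreover have "op_poly T x p = 0"
      using ij(2) by (simp add: p_def op_poly_add op_poly_monom f_def
          complex_vector.scale_minus_left scaleC_one del: minus_monom)
    ultimately show ?thesis
      by blast
  qed
  then show ?thesis
    using eigenvector_of_annihilator[OF G x] by blast
qed

end

text \<open>Take a maximal orthonormal set of eigenvectors. By \<open>orth\<close> its complement in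
  \<open>E\<close> is invariant, and a nonzero complement would contain a further eigenvector.
  Finite dimension enters as finiteness of orthonormal sets, the form in which compactness provides
  it.\<close>

lemma orthonormal_eigenbasis:
  fixes T :: "'a::complex_inner \<Rightarrow> 'a"
  assumes E: "csubspace E" and fin: "\<And>B. orthonormal_set B \<Longrightarrow> B \<subseteq> E \<Longrightarrow> finite B"
    and T: "clinear_on UNIV T" "\<And>x. x \<in> E \<Longrightarrow> T x \<in> E"
    and orth: "\<And>x e z. x \<in> E \<Longrightarrow> e \<in> E \<Longrightarrow> T e = z *\<^sub>C e \<Longrightarrow> cinner x e = 0 \<Longrightarrow> cinner (T x) e = 0"
  obtains B where "finite B" "orthonormal_set B" "cspan B = E" "card B = cdim E"
    "\<And>b. b \<in> B \<Longrightarrow> \<exists>z. T b = z *\<^sub>C b"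
proof -
  have normalize: "(1 / norm v) *\<^sub>R v \<in> E" "norm ((1 / norm v) *\<^sub>R v) = 1"
    if "v \<in> E" "v \<noteq> 0" for v
    using that E by (simp_all add: scaleR_scaleC[of _ v] norm_scaleC norm_divide
        complex_vector.subspace_scale)
  have span: "cspan B = E"
    if B: "B \<subseteq> E" "orthonormal_set B" and zero: "\<And>x. x \<in> E \<Longrightarrow> \<forall>b\<in>B. cinner x b = 0 \<Longrightarrow> x = 0" for B
  proof
    show "cspan B \<subseteq> E"
      using B(1) E by (rule complex_vector.span_minimal)
    show "E \<subseteq> cspan B"
    proof
      fix x assume x: "x \<in> E"
      let ?s = "\<Sum>c\<in>B. cinner x c *\<^sub>C c"
      have s: "?s \<in> cspan B"
        by (intro complex_vector.span_sum complex_vector.span_scale complex_vector.span_base)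
      then have "x - ?s \<in> E"
        using \<open>cspan B \<subseteq> E\<close> x E by (auto intro: complex_vector.subspace_diff)
      then have "x - ?s = 0"
        using zero orthonormal_expansion_remainder[OF B(2) fin[OF B(2,1)]] by blast
      then show "x \<in> cspan B"
        using s by simp
    qed
  qed
  \<comment> \<open>An arbitrary orthonormal basis of \<open>E\<close>, chosen regardless of
    \<open>T\<close>, to have a finite spanning set for the dimension count.\<close>
  obtain F where F: "F \<subseteq> E" "orthonormal_set F"
    "\<And>v. v \<in> E \<Longrightarrow> norm v = 1 \<Longrightarrow> \<exists>b\<in>F. cinner v b \<noteq> 0"
    using maximal_orthonormal_set by blast
  have spanF: "cspan F = E"
  proof (rule span[OF F(1,2)])
    fix x assume "x \<in> E" "\<forall>b\<in>F. cinner x b = 0"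
    then show "x = 0"
      using F(3)[OF normalize, of x] by (auto simp: cinner_scaleR_left)
  qed
  define Q where "Q = {v \<in> E. \<exists>z. T v = z *\<^sub>C v}"
  obtain B where B: "B \<subseteq> Q" "orthonormal_set B"
    "\<And>v. v \<in> Q \<Longrightarrow> norm v = 1 \<Longrightarrow> \<exists>b\<in>B. cinner v b \<noteq> 0"
    using maximal_orthonormal_set by blast
  have BE: "B \<subseteq> E"
    using B(1) by (auto simp: Q_def)
  have spanB: "cspan B = E"
  proof (rule span[OF BE B(2)])
    fix x assume x: "x \<in> E" "\<forall>b\<in>B. cinner x b = 0"
    show "x = 0"
    proof (rule ccontr)
      assume "x \<noteq> 0"
      define G where "G = {y \<in> E. \<forall>b\<in>B. cinner y b = 0}"
      have "csubspace G"
        using E unfolding G_def complex_vector.subspace_def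
        by (auto simp: cinner_add_left cinner_scaleC_left cinner.zero_left)
      moreover have "T y \<in> G" if "y \<in> G" for y
        using that B(1) T(2) orth by (fastforce simp: G_def Q_def)
      moreover have "G \<subseteq> cspan F"
        by (auto simp: G_def spanF)
      ultimately obtain v z where v: "v \<in> G" "v \<noteq> 0" "T v = z *\<^sub>C v"
        using finite_dimensional_eigenvector[OF T(1) fin[OF F(2,1)], of G x] x \<open>x \<noteq> 0\<close>
        by (auto simp: G_def)
      have vE: "v \<in> E"
        using v(1) by (simp add: G_def)
      have "(1 / norm v) *\<^sub>R v \<in> Q"
        using normalize(1)[OF vE v(2)] v(3)
        by (auto simp: Q_def clinear_UNIV[OF T(1)] scaleR_scaleC scaleC_scaleC mult.commute)
      from B(3)[OF this normalize(2)[OF vE v(2)]] v(1) show False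
        by (auto simp: G_def cinner_scaleR_left)
    qed
  qed
  have fB: "finite B"
    using fin B(2) BE .
  have "cspan E = E"
    using E by simp
  with spanB have "cspan B = cspan E"
    by (rule trans[OF _ sym])
  then have "cdim E = card B"
    using orthonormal_set_independent[OF B(2) fB] by (rule complex_vector.dim_eq_card)
  then show ?thesis
    using that[OF fB B(2) spanB] B(1) by (auto simp: Q_def)
qed

section \<open>Sums of diagonal operators and isometries\<close>

lemma closure_cspan_eq_UNIV:
  fixes X :: "'a::chilbert_space set"
  assumes "\<And>x. (\<And>y. y \<in> X \<Longrightarrow> cinner x y = 0) \<Longrightarrow> x = 0"
  shows "closure (cspan X) = UNIV"
proof -
  have "x \<in> closure (cspan X)" for x
  proof -
    obtain y where y: "y \<in> closure (cspan X)" "\<And>z. z \<in> closure (cspan X) \<Longrightarrow> cinner (x - y) z = 0"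
      using orthogonal_decomposition[OF closed_csubspace_closure_cspan, of X x] by blast
    then have "x - y = 0"
      using assms closure_cspan_superset by blast
    then show ?thesis
      using y(1) by simp
  qed
  then show ?thesis
    by blast
qed

lemma clinear_on_0:
  assumes "clinear_on S T" "0 \<in> S"
  shows "T 0 = 0"
  using clinear_onD(1)[OF assms(1,2,2)] by simp

lemma bounded_op_on_subset:
  assumes "bounded_op T" "\<And>x. x \<in> S \<Longrightarrow> T x \<in> S"
  shows "bounded_op_on S T"
  using assms by (auto simp: bounded_op_on_def clinear_on_def)

lemma selfadjoint_op_eigenvectors_orthogonal:
  assumes A: "selfadjoint_op A"
    and x: "A x = of_real a *\<^sub>C x" and y: "A y = of_real b *\<^sub>C y" and ab: "a \<noteq> b"
  shows "cinner x y = 0"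
proof -
  have "cinner (A x) y = cinner x (A y)"
    using A by (simp add: selfadjoint_op_def)
  then show ?thesis
    using ab by (simp add: x y cinner_scaleC_left cinner_scaleC_right)
qed

text \<open>Since \<open>A\<close> is determined by <y, A x> = <T y, T x>, testing against the total
  set shows that it multiplies each eigenvector in \<open>X\<close> by |d|^2 and fixes
  \<open>N\<close>. Hence it commutes with \<open>T\<close> on a total set.\<close>

lemma quasinormal_diagonal_plus_isometry:
  fixes T :: "'a::chilbert_space \<Rightarrow> 'a"
  assumes T: "bounded_op T"
    and eig: "\<And>f. f \<in> X \<Longrightarrow> \<exists>d. T f = d *\<^sub>C f"
    and orth: "\<And>e f. e \<in> X \<Longrightarrow> f \<in> X \<Longrightarrow> e \<noteq> f \<Longrightarrow> cinner e f = 0"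
    and XN: "\<And>f n. f \<in> X \<Longrightarrow> n \<in> N \<Longrightarrow> cinner f n = 0"
    and N: "\<And>n. n \<in> N \<Longrightarrow> T n \<in> N"
      "\<And>m n. m \<in> N \<Longrightarrow> n \<in> N \<Longrightarrow> cinner (T m) (T n) = cinner m n"
    and total: "closure (cspan (X \<union> N)) = UNIV"
  shows "quasinormal T"
proof -
  define A where "A = adj T \<circ> T"
  have bA: "bounded_op A"
    unfolding A_def by (intro bounded_op_compose bounded_op_adj T)
  note linA = clinear_UNIV[OF bounded_opD(1)[OF bA]] and linT = clinear_UNIV[OF bounded_opD(1)[OF T]]
  have A: "cinner y (A x) = cinner (T y) (T x)" for x y
    by (simp add: A_def cinner_adj_right[OF T])
  have NX: "cinner n f = 0" if "f \<in> X" "n \<in> N" for f n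
    using XN[OF that] cinner_eq_0_commute by blast
  have A_eqI: "A x = z" if eq: "\<And>y. y \<in> X \<union> N \<Longrightarrow> cinner (T y) (T x) = cinner y z" for x z
  proof -
    have "closure (cspan (X \<union> N)) \<subseteq> {y. \<forall>u\<in>{A x - z}. cinner y u = 0}"
      by (rule closure_cspan_minimal[OF closed_csubspace_orthogonal])
        (auto simp: cinner.diff_right A eq)
    then have "cinner (A x - z) (A x - z) = 0"
      unfolding total by blast
    then show ?thesis
      by (simp add: cinner_self)
  qed
  have A_X: "A f = (d * cnj d) *\<^sub>C f" if f: "f \<in> X" and d: "T f = d *\<^sub>C f" for f d
  proof (rule A_eqI)
    fix y assume y: "y \<in> X \<union> N"
    show "cinner (T y) (T f) = cinner y ((d * cnj d) *\<^sub>C f)"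
    proof (cases "y = f")
      case True
      then show ?thesis
        by (simp add: d cinner_scaleC_left cinner_scaleC_right)
    next
      case False
      then have "cinner y f = 0" "cinner (T y) f = 0"
        using y orth[OF _ f, of y] NX[OF f] N(1) eig[of y] by (auto simp: cinner_scaleC_left)
      then show ?thesis
        by (simp add: d cinner_scaleC_right)
    qed
  qed
  have A_N: "A n = n" if n: "n \<in> N" for n
  proof (rule A_eqI)
    fix y assume "y \<in> X \<union> N"
    then show "cinner (T y) (T n) = cinner y n"
      using XN n N eig[of y] by (auto simp: cinner_scaleC_left)
  qed
  have "(T \<circ> A) x = (A \<circ> T) x" for x
  proof (rule bounded_op_eq_on_closure_cspan[where X = "X \<union> N" and S = "T \<circ> A" and T = "A \<circ> T"])
    show "bounded_op (T \<circ> A)" "bounded_op (A \<circ> T)"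
      using T bA by (simp_all add: bounded_op_compose)
    show "x \<in> closure (cspan (X \<union> N))"
      by (simp add: total)
    fix y assume "y \<in> X \<union> N"
    then show "(T \<circ> A) y = (A \<circ> T) y"
    proof
      assume y: "y \<in> X"
      obtain d where d: "T y = d *\<^sub>C y"
        using eig[OF y] by blast
      show ?thesis
        by (simp add: A_X[OF y d] d linT linA scaleC_scaleC mult_ac)
    qed (simp add: A_N N(1))
  qed
  then show ?thesis
    using T by (auto simp: quasinormal_def A_def)
qed

text \<open>Pull back along \<open>V\<close>: preimages of the diagonal basis are orthogonal
  eigenvectors of \<open>T\<close>, and on the preimage \<open>N'\<close> of the second summand
  \<open>T\<close> preserves inner products.\<close>

lemma quasinormal_unitarily_equivalent_sum:
  fixes T :: "'a::chilbert_space \<Rightarrow> 'a"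
    and M :: "'b::chilbert_space set" and N :: "'c::chilbert_space set"
  assumes T: "bounded_op T" and D: "diagonal_op_on M I d D"
    and N: "closed_csubspace N" and U: "isometry_on N U"
    and equiv: "unitarily_equivalent UNIV T (M \<times> N) (map_prod D U)"
  shows "quasinormal T"
proof -
  obtain V where V: "clinear_on UNIV V" "range V = M \<times> N"
      "\<And>x y. cinner (V x) (V y) = cinner x y" "\<And>x. V (T x) = map_prod D U (V x)"
    using equiv unfolding unitarily_equivalent_def unitary_between_def by auto
  note linV = clinear_UNIV[OF V(1)]
  have V_inj: "x = y" if "V x = V y" for x y
  proof -
    have "cinner (x - y) (x - y) = cinner (V (x - y)) (V (x - y))"
      by (simp add: V(3))
    also have "\<dots> = 0"
      using that by (simp add: linV cinner.zero_left)
    finally show ?thesis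
      by (simp add: cinner_self)
  qed
  obtain e where e: "\<And>i j. i \<in> I \<Longrightarrow> j \<in> I \<Longrightarrow> cinner (e i) (e j) = (if i = j then 1 else 0)"
    and M: "closure (cspan (e ` I)) = M" and De: "\<And>i. i \<in> I \<Longrightarrow> D (e i) = d i *\<^sub>C e i"
    and lD: "clinear_on M D"
    using D unfolding diagonal_op_on_def orthonormal_basis_of_def bounded_op_on_def by metis
  have bU: "bounded_op_on N U"
    using U by (simp add: isometry_on_def)
  then have UN: "\<And>x. x \<in> N \<Longrightarrow> U x \<in> N" and lU: "clinear_on N U"
    by (auto simp: bounded_op_on_def)
  have M': "closed_csubspace M"
    using closed_csubspace_closure_cspan[of "e ` I"] by (simp only: M)
  \<comment> \<open>\<open>D\<close> and \<open>U\<close> are linear only on \<open>M\<close> and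
    \<open>N\<close>, so their values at 0 come from 0 lying in these subspaces.\<close>
  have D0: "D 0 = 0" and U0: "U 0 = 0"
    using clinear_on_0[OF lD closed_csubspaceD(3)[OF M']]
      clinear_on_0[OF lU closed_csubspaceD(3)[OF N]] .
  have eM: "e i \<in> M" if "i \<in> I" for i
    using that subsetD[OF closure_cspan_superset, of "e i" "e ` I"] by (simp add: M)
  have "\<exists>x. V x = (e i, 0)" if "i \<in> I" for i
  proof -
    have "(e i, 0) \<in> range V"
      using eM[OF that] closed_csubspaceD(3)[OF N] by (simp add: V(2))
    then show ?thesis
      by (metis imageE)
  qed
  then obtain f where f: "\<And>i. i \<in> I \<Longrightarrow> V (f i) = (e i, 0)"
    by metis
  define N' where "N' = {x. \<exists>b\<in>N. V x = (0, b)}"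
  show ?thesis
  proof (rule quasinormal_diagonal_plus_isometry[where X = "f ` I" and N = N'])
    show "bounded_op T"
      by (fact T)
    show "\<exists>c. T x = c *\<^sub>C x" if x: "x \<in> f ` I" for x
    proof -
      obtain i where i: "i \<in> I" "x = f i"
        using x by blast
      have "V (T x) = V (d i *\<^sub>C x)"
        by (simp add: i f V(4) De U0 linV scaleC_prod_def)
      then show ?thesis
        using V_inj by blast
    qed
    show "cinner x y = 0" if "x \<in> f ` I" "y \<in> f ` I" "x \<noteq> y" for x y
    proof -
      obtain i j where ij: "i \<in> I" "x = f i" "j \<in> I" "y = f j"
        using \<open>x \<in> f ` I\<close> \<open>y \<in> f ` I\<close> by blast
      have "cinner x y = cinner (e i) (e j)"
        using V(3)[of x y] f ij by (simp add: cinner_prod_def cinner.zero_left)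
      then show ?thesis
        using e[of i j] ij \<open>x \<noteq> y\<close> by auto
    qed
    show "cinner x n = 0" if xn: "x \<in> f ` I" "n \<in> N'" for x n
    proof -
      obtain i b where "i \<in> I" "x = f i" "V n = (0, b)"
        using xn by (auto simp: N'_def)
      then show ?thesis
        using V(3)[of x n] f by (simp add: cinner_prod_def cinner.zero_left cinner.zero_right)
    qed
    show "T n \<in> N'" if "n \<in> N'" for n
      using that UN by (auto simp: N'_def V(4) D0)
    show "cinner (T m) (T n) = cinner m n" if mn: "m \<in> N'" "n \<in> N'" for m n
    proof -
      obtain a b where ab: "a \<in> N" "b \<in> N" "V m = (0, a)" "V n = (0, b)"
        using mn by (auto simp: N'_def)
      have "cinner (U a) (U b) = cinner a b"
        using isometry_on_cinner[OF N bU] U ab by blast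
      then show ?thesis
        using V(3)[of "T m" "T n"] V(3)[of m n] ab
        by (simp add: V(4) D0 cinner_prod_def cinner.zero_left)
    qed
    show "closure (cspan (f ` I \<union> N')) = UNIV"
    proof (rule closure_cspan_eq_UNIV)
      fix x assume x: "\<And>y. y \<in> f ` I \<union> N' \<Longrightarrow> cinner x y = 0"
      obtain a b where ab: "V x = (a, b)"
        by fastforce
      have "V x \<in> M \<times> N"
        using V(2) by blast
      then have abMN: "a \<in> M" "b \<in> N"
        by (simp_all add: ab)
      have "cinner a (e i) = 0" if "i \<in> I" for i
        using V(3)[of x "f i"] x[of "f i"] that f[OF that]
        by (simp add: ab cinner_prod_def cinner.zero_right)
      then have "closure (cspan (e ` I)) \<subseteq> {y. \<forall>z\<in>{a}. cinner y z = 0}"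
        by (intro closure_cspan_minimal closed_csubspace_orthogonal)
          (auto simp: cinner_eq_0_commute[of a])
      then have "cinner a a = 0"
        using abMN(1) M by blast
      moreover have "cinner b b = 0"
      proof -
        have "(0, b) \<in> range V"
          using abMN closed_csubspaceD(3)[OF M'] by (simp add: V(2))
        then obtain n where n: "V n = (0, b)"
          by (metis imageE)
        then have "n \<in> N'"
          using abMN(2) by (auto simp: N'_def)
        then show ?thesis
          using V(3)[of x n] x[of n] by (simp add: ab n cinner_prod_def cinner.zero_right)
      qed
      ultimately have "cinner x x = 0"
        using V(3)[of x x] by (simp add: ab cinner_prod_def)
      then show "x = 0"
        by (simp add: cinner_self)
    qed
  qed
qed

text \<open>The case of an absent isometric summand is reduced to the other one by adding the
  identity on the zero space.\<close>

lemma quasinormal_equivalent_to_sum: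
  fixes T :: "'a::chilbert_space \<Rightarrow> 'a"
    and M :: "'b::chilbert_space set" and N :: "'c::chilbert_space set"
  assumes T: "bounded_op T" and D: "diagonal_op_on M I d D"
    and N: "closed_csubspace N" and U: "isometry_on N U"
    and equiv: "equivalent_to_sum T M D c N U"
  shows "quasinormal T"
proof (cases "c = 0")
  case False
  then show ?thesis
    using equiv quasinormal_unitarily_equivalent_sum[OF T D N U] by (simp add: equivalent_to_sum_def)
next
  case True
  then obtain V where V: "unitary_between UNIV M V" "\<And>x. V (T x) = D (V x)"
    using equiv by (auto simp: equivalent_to_sum_def unitarily_equivalent_def)
  have "unitary_between UNIV (M \<times> {0 :: 'c}) (\<lambda>x. (V x, 0))"
    using V(1) by (auto simp: unitary_between_def clinear_on_def scaleC_prod_def cinner_prod_def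
        cinner.zero_left)
  then have "unitarily_equivalent UNIV T (M \<times> {0 :: 'c}) (map_prod D id)"
    unfolding unitarily_equivalent_def using V(2) by (intro exI[of _ "\<lambda>x. (V x, 0)"]) simp
  moreover have zero: "closed_csubspace {0 :: 'c}"
    by (rule closed_csubspaceI) auto
  moreover have "isometry_on {0 :: 'c} id"
    using zero by (subst isometry_on_cinner)
      (auto simp: bounded_op_on_def clinear_on_def intro: exI[of _ 1])
  ultimately show ?thesis
    using quasinormal_unitarily_equivalent_sum[OF T D] by blast
qed

section \<open>Compact perturbations of isometries\<close>

lemma seq_compact_op_isometry_plus_compact:
  fixes T W K :: "'a::chilbert_space \<Rightarrow> 'a"
  assumes T: "bounded_op T" and W: "isometry_on UNIV W" and K: "compact_op K"
    and T_eq: "\<And>x. T x = W x + K x"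
  shows "seq_compact_op (\<lambda>x. adj T (T x) - x)"
proof -
  have bW: "bounded_op W" and WW: "\<And>x. adj W (W x) = x"
    using W by (auto simp: isometry_on_def)
  have cK: "seq_compact_op K"
    using K by (rule compact_op_imp_seq_compact_op)
  then have bK: "bounded_op K"
    by (simp add: seq_compact_op_def)
  have adjT: "adj T y = adj W y + adj K y" for y
    by (rule cinner_ext)
      (simp add: cinner_add_right cinner_adj_right T bW bK T_eq cinner_add_left)
  have "adj T (T x) - x = (adj W \<circ> K) x + ((adj K \<circ> W) x + (adj K \<circ> K) x)" for x
    by (simp add: adjT T_eq WW clinear_UNIV[OF bounded_opD(1)[OF bounded_op_adj[OF bW]]]
        clinear_UNIV[OF bounded_opD(1)[OF bounded_op_adj[OF bK]]])
  moreover have "seq_compact_op (\<lambda>x. (adj W \<circ> K) x + ((adj K \<circ> W) x + (adj K \<circ> K) x))"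
    by (intro seq_compact_op_add seq_compact_op_compose_left[of "adj W"] bounded_op_adj
        seq_compact_op_compose_right[of "adj K"] seq_compact_op_adj bW bK cK)
  ultimately show ?thesis
    by simp
qed

section \<open>Eigenspaces of T*T and of its square root\<close>

lemma selfadjoint_op_adj_compose:
  fixes T :: "'a::chilbert_space \<Rightarrow> 'a"
  assumes T: "bounded_op T"
  shows "selfadjoint_op (adj T \<circ> T)"
  using T by (simp add: selfadjoint_op_def bounded_op_compose bounded_op_adj cinner_adj_right
      cinner_adj_left)

text \<open>Pairing with \<open>e\<close> exhibits the eigenvalue as an explicit nonnegative
  function of the eigenvector, as the construction of the square root demands.\<close>

lemma eigenvalue_adj_compose:
  fixes T :: "'a::chilbert_space \<Rightarrow> 'a"
  assumes T: "bounded_op T" and e: "adj T (T e) = m *\<^sub>C e" "e \<noteq> 0"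
  shows "m = of_real ((norm (T e) / norm e)\<^sup>2)"
proof -
  have "m * cinner e e = cinner (adj T (T e)) e"
    by (simp add: e(1) cinner_scaleC_left)
  also have "\<dots> = cinner (T e) (T e)"
    by (rule cinner_adj_left[OF T])
  finally show ?thesis
    using e(2) by (simp add: cinner_self field_simps)
qed

text \<open>All eigenvectors of T*T together are total: a vector orthogonal to them lies in the
  kernel of T*T - I, hence is itself an eigenvector, for the eigenvalue 1, and is orthogonal to
  itself.\<close>

lemma op_sqrt_adj_compose:
  fixes T :: "'a::chilbert_space \<Rightarrow> 'a"
  assumes T: "bounded_op T" and cpt: "seq_compact_op (\<lambda>x. adj T (T x) - x)"
  shows "positive_op (op_sqrt (adj T \<circ> T))"
    "op_sqrt (adj T \<circ> T) \<circ> op_sqrt (adj T \<circ> T) = adj T \<circ> T"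
proof -
  define A where "A = adj T \<circ> T"
  have A: "selfadjoint_op A"
    unfolding A_def by (rule selfadjoint_op_adj_compose[OF T])
  define X where "X = {e. \<exists>l. A e = l *\<^sub>C e}"
  define l where "l e = (norm (T e) / norm e)\<^sup>2" for e
  have eig: "A e = of_real (l e) *\<^sub>C e" if e: "e \<in> X" for e
  proof (cases "e = 0")
    case True
    then show ?thesis
      using A by (simp add: selfadjoint_op_def clinear_UNIV[OF bounded_opD(1)])
  next
    case False
    obtain m where m: "A e = m *\<^sub>C e"
      using e by (auto simp: X_def)
    then have "m = of_real (l e)"
      unfolding l_def A_def by (intro eigenvalue_adj_compose[OF T _ False]) simp
    then show ?thesis
      by (simp add: m)
  qed
  have total: "closure (cspan X) = UNIV"
  proof (rule closure_cspan_eq_UNIV)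
    fix x assume x: "\<And>y. y \<in> X \<Longrightarrow> cinner x y = 0"
    have "adj T (T x) - x = 0"
    proof (rule compact_selfadjoint_orthogonal_eigenvectors[OF _ cpt])
      show "selfadjoint_op (\<lambda>x. adj T (T x) - x)"
        using cpt A by (simp add: selfadjoint_op_def seq_compact_op_def A_def cinner.diff_left
            cinner.diff_right)
      fix m y assume "adj T (T y) - y = m *\<^sub>C y"
      then have "A y = (m + 1) *\<^sub>C y"
        by (simp add: A_def scaleC_add_left scaleC_one algebra_simps)
      then show "cinner x y = 0"
        using x by (auto simp: X_def)
    qed
    then have "A x = 1 *\<^sub>C x"
      by (simp add: A_def scaleC_one)
    then have "x \<in> X"
      unfolding X_def by blast
    then show "x = 0"
      using x[of x] by (simp add: cinner_self)
  qed
  show "positive_op (op_sqrt (adj T \<circ> T))"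
    "op_sqrt (adj T \<circ> T) \<circ> op_sqrt (adj T \<circ> T) = adj T \<circ> T"
    unfolding A_def[symmetric] by (rule op_sqrt_eigenvectors[OF A total _ eig]; simp add: l_def)+
qed

text \<open>Carries multiplicities from the square root over to T*T; the inclusion from right to
  left is where positivity of \<open>R\<close> enters.\<close>

lemma eigenspace_positive_op_square:
  assumes R: "positive_op R" and b: "0 \<le> b"
  shows "eigenspace R (of_real b) = eigenspace (R \<circ> R) (of_real (b\<^sup>2))"
proof -
  have "clinear_on UNIV R"
    using R by (simp add: positive_op_def bounded_opD)
  then have "R (R x) = of_real (b\<^sup>2) *\<^sub>C x" if "R x = of_real b *\<^sub>C x" for x
    using that by (simp add: clinear_UNIV scaleC_scaleC power2_eq_square)
  then have "R x = of_real b *\<^sub>C x \<longleftrightarrow> (R \<circ> R) x = of_real (b\<^sup>2) *\<^sub>C x" for x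
    unfolding comp_apply using positive_op_sqrt_eigenvector[OF R b, of x] by blast
  then show ?thesis
    unfolding eigenspace_def by (rule Collect_cong)
qed

lemma eigenvalues_positive_op:
  assumes R: "positive_op R" and b: "b \<in> eigenvalues R"
  shows "b = of_real (Re b)" "0 \<le> Re b"
proof -
  obtain x where x: "x \<noteq> 0" "R x = b *\<^sub>C x"
    using b by (auto simp: eigenvalues_def)
  have "cinner (R x) x \<in> \<real>\<^sub>\<ge>\<^sub>0"
    using R by (simp add: positive_op_def)
  then have "b * of_real ((norm x)\<^sup>2) \<in> \<real>\<^sub>\<ge>\<^sub>0"
    by (simp add: x cinner_scaleC_left cinner_self)
  then have "0 \<le> Re b \<and> Im b = 0"
    using x(1) by (auto simp: complex_nonneg_Reals_iff zero_le_mult_iff simp flip: of_real_power)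
  then show "b = of_real (Re b)" "0 \<le> Re b"
    by (simp_all add: complex_eq_iff)
qed

text \<open>On \<open>E\<close> the operator \<open>T\<close> scales inner products by b^2. This
  supplies the invariant complements that \<open>orthonormal_eigenbasis\<close> asks for, and it
  forces each eigenvalue of \<open>T\<close> on \<open>E\<close> to have modulus b.\<close>

lemma quasinormal_diagonal_on_eigenspace:
  fixes T :: "'a::chilbert_space \<Rightarrow> 'a"
  assumes T: "quasinormal T" and cpt: "seq_compact_op (\<lambda>x. adj T (T x) - x)"
    and b: "0 \<le> b" "b \<noteq> 1" and E: "E = eigenspace (adj T \<circ> T) (of_real (b\<^sup>2))"
  shows "\<exists>h t. inj_on h {1..cdim E} \<and> orthonormal_set (h ` {1..cdim E}) \<and>
    cspan (h ` {1..cdim E}) = E \<and>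
    (\<forall>j\<in>{1..cdim E}. T (h j) = (of_real b * exp (\<i> * of_real (t j))) *\<^sub>C h j)"
proof -
  have bT: "bounded_op T" and comm: "T (adj T (T x)) = adj T (T (T x))" for x
    using T by (auto simp: quasinormal_def fun_eq_iff)
  note lin = clinear_UNIV[OF bounded_opD(1)[OF bT]]
  have TT: "cinner (T x) (T y) = of_real (b\<^sup>2) * cinner x y" if "y \<in> E" for x y
  proof -
    have "cinner (T x) (T y) = cinner x (adj T (T y))"
      by (simp only: cinner_adj_right[OF bT])
    then show ?thesis
      using that by (simp add: E eigenspace_def cinner_scaleC_right)
  qed
  have "b\<^sup>2 \<noteq> 1"
    using b by (simp add: power2_eq_1_iff)
  have E': "csubspace E"
    unfolding E using bT
    by (intro closed_csubspaceD(2) closed_csubspace_eigenspace bounded_op_compose bounded_op_adj)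
  obtain B where B: "finite B" "orthonormal_set B" "cspan B = E" "card B = cdim E"
    and eig: "\<And>e. e \<in> B \<Longrightarrow> \<exists>z. T e = z *\<^sub>C e"
  proof (rule orthonormal_eigenbasis[OF E' _ bounded_opD(1)[OF bT]])
    fix B assume B: "orthonormal_set B" "B \<subseteq> E"
    show "finite B"
    proof (rule finite_orthonormal_set_compact_eigenspace[OF cpt _ B(1)])
      \<comment> \<open>The compact operator T*T - I acts on \<open>E\<close> as b^2 - 1, which is
        nonzero.\<close>
      show "of_real (b\<^sup>2 - 1) \<noteq> (0 :: complex)"
        using \<open>b\<^sup>2 \<noteq> 1\<close> by (simp del: of_real_diff)
      show "B \<subseteq> eigenspace (\<lambda>x. adj T (T x) - x) (of_real (b\<^sup>2 - 1))"
        using B(2) by (auto simp: E eigenspace_def complex_vector.scale_left_diff_distrib scaleC_one)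
    qed
  next
    show "T x \<in> E" if "x \<in> E" for x
      using that by (simp add: E eigenspace_def lin flip: comm)
    \<comment> \<open>For z nonzero, pair \<open>T x\<close> with T e = z e. If z = 0 and e is
      nonzero, then b = 0 and \<open>T\<close> vanishes on \<open>E\<close>.\<close>
    show "cinner (T x) e = 0" if "x \<in> E" "e \<in> E" "T e = z *\<^sub>C e" "cinner x e = 0" for x e z
    proof (cases "z = 0 \<and> e \<noteq> 0")
      case True
      then have "of_real (b\<^sup>2) * cinner e e = 0"
        using TT[OF that(2), of e] that(3) by (simp add: cinner.zero_left)
      then have "b = 0"
        using True by (simp add: cinner_self)
      then have "cinner (T x) (T x) = 0"
        using TT[OF that(1), of x] by simp
      then show ?thesis
        by (simp add: cinner_self cinner.zero_left)
    next
      case False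
      have "cnj z * cinner (T x) e = 0"
        using TT[OF that(2), of x] that(3,4) by (simp add: cinner_scaleC_right)
      then show ?thesis
        using False by (auto simp: cinner.zero_right)
    qed
  qed blast
  obtain h where h: "bij_betw h {1..cdim E} B"
    using ex_bij_betw_nat_finite_1[OF B(1)] B(4) by auto
  have hB: "h j \<in> B" if "j \<in> {1..cdim E}" for j
    using h that by (auto simp: bij_betw_def)
  have "\<exists>s. T e = (of_real b * exp (\<i> * of_real s)) *\<^sub>C e" if e: "e \<in> B" for e
  proof -
    obtain z where z: "T e = z *\<^sub>C e"
      using eig[OF e] by blast
    have "e \<in> E"
      using B(3) complex_vector.span_superset e by blast
    from TT[OF this, of e] have "z * cnj z = of_real (b\<^sup>2)"
      using orthonormal_setD[OF B(2) e e]
      by (simp add: z cinner_scaleC_left cinner_scaleC_right mult.commute)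
    then have "of_real ((cmod z)\<^sup>2) = complex_of_real (b\<^sup>2)"
      by (simp only: complex_norm_square)
    then have "cmod z = b"
      using b(1) by (simp only: of_real_eq_iff) (simp add: power2_eq_iff_nonneg)
    \<comment> \<open>Polar form; for b = 0 both sides vanish whatever the phase.\<close>
    then have "z = of_real b * exp (\<i> * of_real (Arg z))"
      using rcis_cmod_Arg[of z] by (simp add: rcis_def cis_conv_exp)
    then show ?thesis
      using z by metis
  qed
  then obtain s where "\<And>e. e \<in> B \<Longrightarrow> T e = (of_real b * exp (\<i> * of_real (s e))) *\<^sub>C e"
    by metis
  then have "\<forall>j\<in>{1..cdim E}. T (h j) = (of_real b * exp (\<i> * of_real ((s \<circ> h) j))) *\<^sub>C h j"
    using hB by auto
  moreover have "inj_on h {1..cdim E}" "h ` {1..cdim E} = B"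
    using h by (auto simp: bij_betw_def)
  ultimately show ?thesis
    using B(2,3) by blast
qed

text \<open>The unitary sends x to (p x, x - p x), with \<open>p\<close> the projection onto
  \<open>M\<close>. Linearity of \<open>p\<close> and its commuting with \<open>T\<close> both
  follow from uniqueness of the decomposition, \<open>p_eq\<close>.\<close>

lemma unitarily_equivalent_orthogonal_sum:
  fixes T :: "'a::chilbert_space \<Rightarrow> 'a"
  assumes T: "bounded_op T" and M: "closed_csubspace M" "\<And>x. x \<in> M \<Longrightarrow> T x \<in> M"
    and N: "closed_csubspace N" "\<And>x. x \<in> N \<Longrightarrow> T x \<in> N"
    and MN: "\<And>x y. x \<in> M \<Longrightarrow> y \<in> N \<Longrightarrow> cinner x y = 0"
    and perp: "\<And>x. (\<And>y. y \<in> M \<Longrightarrow> cinner x y = 0) \<Longrightarrow> x \<in> N"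
  shows "unitarily_equivalent UNIV T (M \<times> N) (map_prod T T)"
proof -
  note lin = clinear_UNIV[OF bounded_opD(1)[OF T]]
  have "\<exists>y. y \<in> M \<and> x - y \<in> N" for x
    using orthogonal_decomposition[OF M(1), of x] perp by metis
  then obtain p where p: "\<And>x. p x \<in> M" "\<And>x. x - p x \<in> N"
    by metis
  have p_eq: "p x = a" if a: "a \<in> M" "x - a \<in> N" for x a
  proof -
    have "p x - a \<in> M"
      using p(1) a(1) by (rule closed_csubspaceD(5)[OF M(1)])
    moreover have "(x - a) - (x - p x) \<in> N"
      using a(2) p(2) by (rule closed_csubspaceD(5)[OF N(1)])
    then have "p x - a \<in> N"
      by simp
    ultimately have "cinner (p x - a) (p x - a) = 0"
      by (rule MN)
    then show ?thesis
      by (simp add: cinner_self)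
  qed
  define V where "V x = (p x, x - p x)" for x
  have p_add: "p (x + y) = p x + p y" for x y
  proof (rule p_eq)
    show "p x + p y \<in> M"
      by (intro closed_csubspaceD(4)[OF M(1)] p)
    have "(x - p x) + (y - p y) \<in> N"
      by (intro closed_csubspaceD(4)[OF N(1)] p)
    then show "x + y - (p x + p y) \<in> N"
      by (simp add: algebra_simps)
  qed
  have p_scale: "p (a *\<^sub>C x) = a *\<^sub>C p x" for a x
  proof (rule p_eq)
    show "a *\<^sub>C p x \<in> M"
      by (intro closed_csubspaceD(6)[OF M(1)] p)
    have "a *\<^sub>C (x - p x) \<in> N"
      by (intro closed_csubspaceD(6)[OF N(1)] p)
    then show "a *\<^sub>C x - a *\<^sub>C p x \<in> N"
      by (simp add: complex_vector.scale_right_diff_distrib)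
  qed
  have pT: "p (T x) = T (p x)" for x
  proof (rule p_eq)
    show "T (p x) \<in> M"
      by (intro M p)
    have "T (x - p x) \<in> N"
      by (intro N p)
    then show "T x - T (p x) \<in> N"
      by (simp add: lin)
  qed
  have "clinear_on UNIV V"
    by (auto simp: clinear_on_def V_def p_add p_scale scaleC_prod_def
        complex_vector.scale_right_diff_distrib)
  moreover have "range V = M \<times> N"
  proof
    show "range V \<subseteq> M \<times> N"
      using p by (auto simp: V_def)
    show "M \<times> N \<subseteq> range V"
    proof
      fix ab assume "ab \<in> M \<times> N"
      then obtain a b where ab: "ab = (a, b)" "a \<in> M" "b \<in> N"
        by blast
      then have "p (a + b) = a"
        by (intro p_eq) auto
      then have "ab = V (a + b)"
        by (simp add: V_def ab)
      then show "ab \<in> range V"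
        by blast
    qed
  qed
  moreover have "cinner (V x) (V y) = cinner x y" for x y
  proof -
    have "cinner (p x) (y - p y) = 0" "cinner (x - p x) (p y) = 0"
      using MN[OF p(1,2)] cinner_eq_0_commute by blast+
    then have "cinner (p x + (x - p x)) (p y + (y - p y)) = cinner (V x) (V y)"
      by (simp only: cinner_add_left cinner_add_right) (simp add: V_def cinner_prod_def)
    then show ?thesis
      by simp
  qed
  moreover have "V (T x) = map_prod T T (V x)" for x
    by (simp add: V_def pT lin)
  ultimately show ?thesis
    unfolding unitarily_equivalent_def unitary_between_def by blast
qed

section \<open>Decomposition of a quasinormal operator\<close>

lemma quasinormal_imp_equivalent_to_sum:
  fixes T :: "'a::chilbert_space \<Rightarrow> 'a" and P :: "complex set" and k :: "complex \<Rightarrow> nat"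
  assumes T: "quasinormal T" and cpt: "seq_compact_op (\<lambda>x. adj T (T x) - x)"
    and P: "P = eigenvalues (op_sqrt (adj T \<circ> T)) - {1}"
    and k: "\<And>b. b \<in> P \<Longrightarrow> k b = multiplicity_of (op_sqrt (adj T \<circ> T)) b"
  shows "\<exists>c\<in>{0, 1}. \<exists>(t :: complex \<Rightarrow> nat \<Rightarrow> real) (M :: 'a set) D (N :: 'a set) U.
       closed_csubspace M \<and>
       diagonal_op_on M (SIGMA b:P. {1..k b}) (\<lambda>(b, j). b * exp (\<i> * of_real (t b j))) D \<and>
       closed_csubspace N \<and> isometry_on N U \<and>
       equivalent_to_sum T M D c N U"
proof -
  have bT: "bounded_op T" and comm: "T (adj T (T x)) = adj T (T (T x))" for x
    using T by (auto simp: quasinormal_def fun_eq_iff)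
  note lin = clinear_UNIV[OF bounded_opD(1)[OF bT]]
  define A where "A = adj T \<circ> T"
  define R where "R = op_sqrt A"
  have R: "positive_op R" "R \<circ> R = A"
    unfolding R_def A_def using op_sqrt_adj_compose[OF bT cpt] by blast+
  have saA: "selfadjoint_op A"
    unfolding A_def by (rule selfadjoint_op_adj_compose[OF bT])
  have P_pos: "b = of_real (Re b)" "0 \<le> Re b" "Re b \<noteq> 1" if "b \<in> P" for b
  proof -
    have "b \<in> eigenvalues R" "b \<noteq> 1"
      using that by (auto simp: P R_def A_def)
    then show "b = of_real (Re b)" "0 \<le> Re b" "Re b \<noteq> 1"
      using eigenvalues_positive_op[OF R(1)] by (auto simp: complex_eq_iff)
  qed
  have eigR: "eigenspace R b = eigenspace A (of_real ((Re b)\<^sup>2))" if "b \<in> P" for b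
    using eigenspace_positive_op_square[OF R(1) P_pos(2)[OF that]] P_pos(1)[OF that] R(2) by simp
  have "\<exists>h t. inj_on h {1..k b} \<and> orthonormal_set (h ` {1..k b}) \<and>
    cspan (h ` {1..k b}) = eigenspace R b \<and>
    (\<forall>j\<in>{1..k b}. T (h j) = (b * exp (\<i> * of_real (t j))) *\<^sub>C h j)" if b: "b \<in> P" for b
  proof -
    have "k b = cdim (eigenspace R b)"
      by (simp add: k[OF b] multiplicity_of_def R_def A_def)
    then show ?thesis
      using quasinormal_diagonal_on_eigenspace[OF T cpt P_pos(2,3)[OF b] eigR[OF b, unfolded A_def]]
        P_pos(1)[OF b] by simp
  qed
  then obtain h t where inj: "\<And>b. b \<in> P \<Longrightarrow> inj_on (h b) {1..k b}"
    and on: "\<And>b. b \<in> P \<Longrightarrow> orthonormal_set (h b ` {1..k b})"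
    and span: "\<And>b. b \<in> P \<Longrightarrow> cspan (h b ` {1..k b}) = eigenspace R b"
    and Th: "\<And>b j. b \<in> P \<Longrightarrow> j \<in> {1..k b} \<Longrightarrow> T (h b j) = (b * exp (\<i> * of_real (t b j))) *\<^sub>C h b j"
    by metis
  define I where "I = (SIGMA b:P. {1..k b})"
  define e where "e = (\<lambda>(b, j). h b j)"
  define M where "M = closure (cspan (e ` I))"
  define N where "N = eigenspace A 1"
  have M: "closed_csubspace M"
    unfolding M_def by (rule closed_csubspace_closure_cspan)
  have N: "closed_csubspace N"
    unfolding N_def using saA by (simp add: selfadjoint_op_def closed_csubspace_eigenspace)
  have AE: "A (h b j) = of_real ((Re b)\<^sup>2) *\<^sub>C h b j" if "b \<in> P" "j \<in> {1..k b}" for b j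
  proof -
    have "h b j \<in> cspan (h b ` {1..k b})"
      using that(2) by (intro complex_vector.span_base) blast
    then show ?thesis
      using span[OF that(1)] eigR[OF that(1)] by (simp add: eigenspace_def)
  qed
  \<comment> \<open>Squaring is injective on nonnegative reals, so distinct elements of
    \<open>P\<close> give distinct eigenvalues of \<open>A\<close>, none equal to 1. Hence the
    blocks are orthogonal to each other and to \<open>N\<close>.\<close>
  have P_sq: "(Re b)\<^sup>2 \<noteq> 1" "b \<noteq> b' \<Longrightarrow> (Re b)\<^sup>2 \<noteq> (Re b')\<^sup>2" if "b \<in> P" "b' \<in> P" for b b'
    using P_pos[OF that(1)] P_pos[OF that(2)]
    by (auto simp: power2_eq_1_iff)
  have TM: "T x \<in> M" if "x \<in> M" for x
  proof (rule maps_closure_cspan[OF bT M _ that[unfolded M_def]])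
    fix y assume "y \<in> e ` I"
    then obtain b j where "b \<in> P" "j \<in> {1..k b}" "y = h b j"
      by (auto simp: e_def I_def)
    then have "T y = (b * exp (\<i> * of_real (t b j))) *\<^sub>C y"
      using Th by blast
    moreover have "y \<in> M"
      using \<open>y \<in> e ` I\<close> unfolding M_def by (rule subsetD[OF closure_cspan_superset])
    ultimately show "T y \<in> M"
      using M by (simp add: closed_csubspaceD)
  qed
  have TN: "T x \<in> N" if "x \<in> N" for x
    using that by (simp add: N_def A_def eigenspace_def lin flip: comm)
  have onb: "cinner (e i) (e j) = (if i = j then 1 else 0)" if "i \<in> I" "j \<in> I" for i j
  proof -
    obtain b m where i: "i = (b, m)" "b \<in> P" "m \<in> {1..k b}"
      using \<open>i \<in> I\<close> by (auto simp: I_def)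
    obtain b' m' where j: "j = (b', m')" "b' \<in> P" "m' \<in> {1..k b'}"
      using \<open>j \<in> I\<close> by (auto simp: I_def)
    show ?thesis
    proof (cases "b = b'")
      case True
      have "cinner (h b m) (h b m') = (if h b m = h b m' then 1 else 0)"
        by (rule orthonormal_setD[OF on[OF i(2)]]) (use i j True in auto)
      then show ?thesis
        using True i j inj[OF i(2)] by (auto simp: e_def inj_on_eq_iff)
    next
      case False
      then have "cinner (h b m) (h b' m') = 0"
        using selfadjoint_op_eigenvectors_orthogonal[OF saA AE[OF i(2,3)] AE[OF j(2,3)]]
          P_sq(2)[OF i(2) j(2)] by blast
      then show ?thesis
        using False i j by (simp add: e_def)
    qed
  qed
  have MN: "cinner x y = 0" if "x \<in> M" "y \<in> N" for x y
  proof -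
    have y: "A y = of_real 1 *\<^sub>C y"
      using \<open>y \<in> N\<close> by (simp add: N_def eigenspace_def)
    have "cinner f y = 0" if f: "f \<in> e ` I" for f
    proof -
      obtain b j where "b \<in> P" "j \<in> {1..k b}" "f = h b j"
        using f by (auto simp: e_def I_def)
      then show ?thesis
        using selfadjoint_op_eigenvectors_orthogonal[OF saA AE y] P_sq(1) by blast
    qed
    then have "M \<subseteq> {x. \<forall>z\<in>{y}. cinner x z = 0}"
      unfolding M_def by (intro closure_cspan_minimal closed_csubspace_orthogonal) auto
    then show ?thesis
      using \<open>x \<in> M\<close> by blast
  qed
  have perp: "x \<in> N" if x: "\<And>y. y \<in> M \<Longrightarrow> cinner x y = 0" for x
  proof -
    have "adj T (T x) - x = 0"
    proof (rule compact_selfadjoint_orthogonal_eigenvectors[OF _ cpt])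
      show "selfadjoint_op (\<lambda>x. adj T (T x) - x)"
        using cpt saA by (simp add: selfadjoint_op_def seq_compact_op_def A_def cinner.diff_left
            cinner.diff_right)
      fix l y assume l: "l \<noteq> 0" and "adj T (T y) - y = l *\<^sub>C y"
      then have Ay: "A y = (l + 1) *\<^sub>C y"
        by (simp add: A_def scaleC_add_left scaleC_one algebra_simps)
      show "cinner x y = 0"
      proof (cases "y = 0")
        case False
        \<comment> \<open>The eigenvalue l + 1 of \<open>A\<close> is s^2, so \<open>y\<close> is an
          eigenvector of \<open>R\<close> for \<open>s\<close>; l nonzero means s different from 1,
          and \<open>y\<close> lies in one of the blocks that span \<open>M\<close>.\<close>
        define s where "s = norm (T y) / norm y"
        have ls: "l + 1 = of_real (s\<^sup>2)"
          unfolding s_def using Ay by (intro eigenvalue_adj_compose[OF bT _ False]) (simp add: A_def)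
        have "s \<ge> 0"
          by (simp add: s_def)
        then have "y \<in> eigenspace R (of_real s)"
          using Ay ls eigenspace_positive_op_square[OF R(1)] R(2) by (simp add: eigenspace_def)
        moreover have "of_real s \<in> P"
        proof -
          have "complex_of_real s \<noteq> 1"
            using ls l by auto
          then show ?thesis
            using \<open>y \<in> eigenspace R (of_real s)\<close> False
            by (auto simp: P eigenvalues_def eigenspace_def R_def A_def)
        qed
        ultimately have "y \<in> cspan (h (of_real s) ` {1..k (of_real s)})"
          by (simp only: span)
        moreover have "h (of_real s) ` {1..k (of_real s)} \<subseteq> e ` I"
          using \<open>of_real s \<in> P\<close> by (force simp: e_def I_def)
        ultimately have "y \<in> cspan (e ` I)"
          using complex_vector.span_mono by blast
        then have "y \<in> M"
          unfolding M_def by (rule subsetD[OF closure_subset])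
        then show ?thesis
          by (rule x)
      qed (simp add: cinner.zero_right)
    qed
    then show ?thesis
      by (simp add: N_def eigenspace_def A_def scaleC_one)
  qed
  \<comment> \<open>Only the restriction of an operator to its subspace matters, so \<open>T\<close>
    itself serves both as the diagonal and as the isometric summand.\<close>
  have diag: "diagonal_op_on M I (\<lambda>(b, j). b * exp (\<i> * of_real (t b j))) T"
    unfolding diagonal_op_on_def orthonormal_basis_of_def
  proof (intro conjI exI[of _ e] ballI)
    show "bounded_op_on M T"
      using bT TM by (rule bounded_op_on_subset)
    show "closure (cspan (e ` I)) = M"
      by (simp add: M_def)
    show "T (e i) = (case i of (b, j) \<Rightarrow> b * exp (\<i> * of_real (t b j))) *\<^sub>C e i" if "i \<in> I" for i
      using that Th by (auto simp: e_def I_def)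
  qed (rule onb)
  have isom: "isometry_on N T"
  proof (subst isometry_on_cinner[OF N bounded_op_on_subset[OF bT TN]])
    show "\<forall>x\<in>N. \<forall>y\<in>N. cinner (T x) (T y) = cinner x y"
      by (simp add: N_def A_def eigenspace_def scaleC_one flip: cinner_adj_right[OF bT])
  qed
  show ?thesis
  \<comment> \<open>The value of \<open>c\<close> records whether 1 is an eigenvalue of T*T; if it
    is not, \<open>M\<close> is the whole space and the identity map is the unitary.\<close>
  proof (cases "N = {0}")
    case True
    have "M = UNIV"
    proof -
      have "x \<in> M" for x
      proof -
        obtain y where "y \<in> M" "x - y \<in> N"
          using orthogonal_decomposition[OF M, of x] perp by metis
        then show ?thesis
          using True by simp
      qed
      then show ?thesis
        by blast
    qed
    then have "equivalent_to_sum T M T 0 N T"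
      unfolding equivalent_to_sum_def unitarily_equivalent_def
      by (auto simp: unitary_between_def clinear_on_def intro!: exI[of _ "\<lambda>x. x"])
    then show ?thesis
      using M N diag isom unfolding I_def by blast
  next
    case False
    then have "equivalent_to_sum T M T 1 N T"
      using unitarily_equivalent_orthogonal_sum[OF bT M TM N TN MN perp]
      by (simp add: equivalent_to_sum_def)
    then show ?thesis
      using M N diag isom unfolding I_def by blast
  qed
qed

theorem theorem1p1:
  fixes T W K :: "'h::chilbert_space \<Rightarrow> 'h"
    and P :: "complex set" and k :: "complex \<Rightarrow> nat"
  assumes separable: "separable_space (euclidean :: 'h topology)"
    and infinite_dimensional: "\<not> (\<exists>B :: 'h set. finite B \<and> cspan B = UNIV)"
    and T_bounded: "bounded_op T"
    and T_not_isometry: "\<not> isometry_on UNIV T"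
    and W_isometry: "isometry_on UNIV W"
    and K_compact: "compact_op K"
    and T_eq: "\<And>x. T x = W x + K x"
    and P_eq: "P = eigenvalues (op_sqrt (adj T \<circ> T)) - {1}"
    and k_eq: "\<And>b. b \<in> P \<Longrightarrow> k b = multiplicity_of (op_sqrt (adj T \<circ> T)) b"
  shows "quasinormal T \<longleftrightarrow>
    (\<exists>c\<in>{0, 1}. \<exists>(t :: complex \<Rightarrow> nat \<Rightarrow> real) (M :: 'h set) D (N :: 'h set) U.
       closed_csubspace M \<and>
       diagonal_op_on M (SIGMA b:P. {1..k b}) (\<lambda>(b, j). b * exp (\<i> * of_real (t b j))) D \<and>
       closed_csubspace N \<and> isometry_on N U \<and>
       equivalent_to_sum T M D c N U)"
proof
  assume "quasinormal T"
  moreover have "seq_compact_op (\<lambda>x. adj T (T x) - x)"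
    using T_bounded W_isometry K_compact T_eq by (rule seq_compact_op_isometry_plus_compact)
  ultimately show "\<exists>c\<in>{0, 1}. \<exists>(t :: complex \<Rightarrow> nat \<Rightarrow> real) (M :: 'h set) D (N :: 'h set) U.
       closed_csubspace M \<and>
       diagonal_op_on M (SIGMA b:P. {1..k b}) (\<lambda>(b, j). b * exp (\<i> * of_real (t b j))) D \<and>
       closed_csubspace N \<and> isometry_on N U \<and>
       equivalent_to_sum T M D c N U"
    using P_eq k_eq by (rule quasinormal_imp_equivalent_to_sum)
qed (use quasinormal_equivalent_to_sum[OF T_bounded] in blast)

end
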